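(* Let $M$ be a manifold of dimension $n>2$. Let $(\nabla,\mathbb E)$ be a conelike nonsingular radiant structure on $M$ such that the one-form $\varrho_i=\mathbb E^pR_{pi}$ vanishes identically. (1) There is a unique $\mathbb E$-invariant connection $\tilde\nabla$ such that $(\tilde\nabla,\mathbb E)$ is a conelike nonsingular radiant structure having antisymmetric Ricci tensor, having the same planelike surfaces as has $(\nabla,\mathbb E)$, and inducing on $|\mathrm{Det}\,T^\ast M|$ the same connection as that induced by $\nabla$. (2) If a Lie group $G$ acts on $M$ by automorphisms of $(\nabla,\mathbb E)$, then $G$ acts by automorphisms of $(\tilde\nabla,\mathbb E)$. (3) If $(\nabla,\mathbb E)$ has symmetric Ricci tensor, then there is a unique Ricci-flat, $\mathbb E$-invariant connection $\tilde\nabla$ such that $(\tilde\nabla,\mathbb E)$ is a conelike nonsingular radiant structure having the same planelike surfaces as has $(\nabla,\mathbb E)$ and inducing on $|\mathrm{Det}\,T^\ast M|$ the same connection as that induced by $\nabla$.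
   Context: Manifolds are smooth and connected. A radiant structure $(\nabla,\mathbb E)$ is a torsion-free affine connection $\nabla$ and a vector field $\mathbb E$ with $\nabla_i\mathbb E^j=\delta_i{}^j$; it is nonsingular if $\mathbb E$ has no zeros. The curvature is defined by $2\nabla_{[i}\nabla_{j]}X^k=R_{ijp}{}^kX^p$ and the Ricci tensor is $R_{ij}=R_{pij}{}^p$. A smoothly immersed surface is planelike if it is totally geodesic for $\nabla$ and everywhere tangent to $\mathbb E$. The radiant structure is conelike if for every $p\in M$ and every two-dimensional subspace $L\subset T_pM$ containing $\mathbb E_p$ there is a smoothly immersed planelike surface through $p$ tangent to $L$ at $p$. Two conelike radiant structures with the same radiant vector field have the same planelike surfaces if each planelike surface of one is a planelike surface of the other. $\tilde\nabla$ is $\mathbb E$-invariant if $\mathfrak L_{\mathbb E}\tilde\nabla=0$. $|\mathrm{Det}\,T^\ast M|$ is the bundle of $1$-densities. *)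

theory Defs
  imports "HOL-Analysis.Analysis" "HOL-Algebra.Group_Action"
begin

section \<open>Smooth maps between open subsets of normed spaces\<close>

abbreviation Dif :: "('v::real_normed_vector \<Rightarrow> 'w::real_normed_vector) \<Rightarrow> 'v \<Rightarrow> 'v \<Rightarrow> 'w"
  where "Dif f x \<equiv> frechet_derivative f (at x)"

text \<open>Both predicates are meant for open \<open>S\<close> in a finite-dimensional space; there, \<open>k\<close> times
  continuously differentiable amounts to continuity of all iterated directional derivatives of
  order at most \<open>k\<close>.\<close>

primrec Ck_on :: "nat \<Rightarrow> 'v::real_normed_vector set \<Rightarrow> ('v \<Rightarrow> 'w::real_normed_vector) \<Rightarrow> bool" where
  "Ck_on 0 S f \<longleftrightarrow> continuous_on S f"
| "Ck_on (Suc k) S f \<longleftrightarrow> f differentiable_on S \<and> (\<forall>v. Ck_on k S (\<lambda>x. Dif f x v))"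

definition smooth_on :: "'v::real_normed_vector set \<Rightarrow> ('v \<Rightarrow> 'w::real_normed_vector) \<Rightarrow> bool"
  where "smooth_on S f \<longleftrightarrow> (\<forall>k. Ck_on k S f)"


section \<open>Manifolds\<close>

text \<open>A chart is a pair of its domain and its coordinate map. A manifold is given by a topology
  (whose \<open>topspace\<close> is the set of points) together with an atlas, which need not be maximal;
  objects on the manifold are described by their components in the charts of the atlas.
  Only the values of a coordinate map on the domain of its chart matter.\<close>

type_synonym ('a, 'v) chart = "'a set \<times> ('a \<Rightarrow> 'v)"

abbreviation chart_dom :: "('a, 'v) chart \<Rightarrow> 'a set" where "chart_dom \<equiv> fst"
abbreviation chart_map :: "('a, 'v) chart \<Rightarrow> 'a \<Rightarrow> 'v" where "chart_map \<equiv> snd"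

definition chart_img :: "('a, 'v) chart \<Rightarrow> 'v set"
  where "chart_img c = chart_map c ` chart_dom c"

definition chart_inv :: "('a, 'v) chart \<Rightarrow> 'v \<Rightarrow> 'a"
  where "chart_inv c = inv_into (chart_dom c) (chart_map c)"

definition is_chart :: "'a topology \<Rightarrow> ('a, 'v::real_normed_vector) chart \<Rightarrow> bool" where
  "is_chart X c \<longleftrightarrow> openin X (chart_dom c) \<and> open (chart_img c) \<and>
     homeomorphic_map (subtopology X (chart_dom c)) (top_of_set (chart_img c)) (chart_map c)"

text \<open>The expression of \<open>f\<close> in the charts \<open>b\<close> and \<open>c\<close>, and the set on which it is meaningful.
  For \<open>f = id\<close> this is the change of coordinates from \<open>b\<close> to \<open>c\<close>.\<close>

definition loc_map :: "('a, 'v) chart \<Rightarrow> ('b, 'w) chart \<Rightarrow> ('a \<Rightarrow> 'b) \<Rightarrow> 'v \<Rightarrow> 'w"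
  where "loc_map b c f = chart_map c \<circ> f \<circ> chart_inv b"

definition loc_dom :: "('a, 'v) chart \<Rightarrow> ('b, 'w) chart \<Rightarrow> ('a \<Rightarrow> 'b) \<Rightarrow> 'v set"
  where "loc_dom b c f = chart_map b ` {p \<in> chart_dom b. f p \<in> chart_dom c}"

text \<open>The model space is any finite-dimensional real normed space. Instances of class
  \<open>euclidean_space\<close> have positive dimension, whereas here dimension zero is possible,
  as is needed for discrete Lie groups. Connectedness is not part of the next definition.\<close>

definition smooth_structure :: "'a topology \<Rightarrow> ('a, 'v::real_normed_vector) chart set \<Rightarrow> bool" where
  "smooth_structure X A \<longleftrightarrow>
     (\<exists>b. finite b \<and> span b = (UNIV :: 'v set)) \<and>
     Hausdorff_space X \<and> second_countable X \<and>
     (\<forall>c\<in>A. is_chart X c) \<and> (\<Union>c\<in>A. chart_dom c) = topspace X \<and>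
     (\<forall>c\<in>A. \<forall>d\<in>A. smooth_on (loc_dom c d id) (loc_map c d id))"

definition smooth_manifold :: "'a topology \<Rightarrow> ('a, 'v::real_normed_vector) chart set \<Rightarrow> bool"
  where "smooth_manifold X A \<longleftrightarrow> smooth_structure X A \<and> connected_space X"

definition smooth_map :: "'a topology \<Rightarrow> ('a, 'v::real_normed_vector) chart set \<Rightarrow>
    'b topology \<Rightarrow> ('b, 'w::real_normed_vector) chart set \<Rightarrow> ('a \<Rightarrow> 'b) \<Rightarrow> bool" where
  "smooth_map X A Y B f \<longleftrightarrow> continuous_map X Y f \<and>
     (\<forall>c\<in>A. \<forall>d\<in>B. smooth_on (loc_dom c d f) (loc_map c d f))"

definition diffeomorphism ::
    "'a topology \<Rightarrow> ('a, 'v::real_normed_vector) chart set \<Rightarrow> ('a \<Rightarrow> 'a) \<Rightarrow> bool" where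
  "diffeomorphism X A f \<longleftrightarrow> smooth_map X A X A f \<and>
     (\<exists>g. smooth_map X A X A g \<and> (\<forall>p\<in>topspace X. g (f p) = p \<and> f (g p) = p))"

definition smooth_immersion :: "'a topology \<Rightarrow> ('a, 'v::real_normed_vector) chart set \<Rightarrow>
    'b topology \<Rightarrow> ('b, 'w::real_normed_vector) chart set \<Rightarrow> ('a \<Rightarrow> 'b) \<Rightarrow> bool" where
  "smooth_immersion X A Y B f \<longleftrightarrow> smooth_map X A Y B f \<and>
     (\<forall>c\<in>A. \<forall>d\<in>B. \<forall>u\<in>loc_dom c d f. inj (Dif (loc_map c d f) u))"

definition prod_atlas ::
    "('a, 'v) chart set \<Rightarrow> ('b, 'w) chart set \<Rightarrow> ('a \<times> 'b, 'v \<times> 'w) chart set" where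
  "prod_atlas A B =
     {(chart_dom c \<times> chart_dom d, map_prod (chart_map c) (chart_map d)) | c d. c \<in> A \<and> d \<in> B}"


section \<open>Vector fields and affine connections\<close>

text \<open>Vector fields are given by their component vectors: \<open>E c x\<close> are the components, with
  respect to the chart \<open>c\<close>, at the point with coordinates \<open>x\<close>. In the same way the tangent space
  at a point is identified with \<open>real^'n\<close> by any chart around that point.\<close>

type_synonym ('a, 'n) vfield = "('a, real^'n) chart \<Rightarrow> real^'n \<Rightarrow> real^'n"

definition smooth_vector_field :: "('a, real^'n) chart set \<Rightarrow> ('a, 'n) vfield \<Rightarrow> bool" where
  "smooth_vector_field A E \<longleftrightarrow>
     (\<forall>c\<in>A. smooth_on (chart_img c) (E c)) \<and>
     (\<forall>c\<in>A. \<forall>d\<in>A. \<forall>x\<in>loc_dom c d id.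
        E d (loc_map c d id x) = Dif (loc_map c d id) x (E c x))"

text \<open>A connection is given by its Christoffel symbols. In a chart, \<open>G x v w\<close> is the vector with
  components \<open>v\<^sup>i w\<^sup>j \<Gamma>\<^sub>i\<^sub>j\<^sup>k\<close>, where \<open>\<nabla>\<^sub>i X\<^sup>k = \<partial>\<^sub>i X\<^sup>k + \<Gamma>\<^sub>i\<^sub>j\<^sup>k X\<^sup>j\<close>.\<close>

type_synonym 'n christoffel = "real^'n \<Rightarrow> real^'n \<Rightarrow> real^'n \<Rightarrow> real^'n"
type_synonym ('a, 'n) connection = "('a, real^'n) chart \<Rightarrow> 'n christoffel"

text \<open>\<open>\<nabla>\<^sub>v Y\<close> at \<open>x\<close>.\<close>

definition covd :: "'n::finite christoffel \<Rightarrow> real^'n \<Rightarrow> (real^'n \<Rightarrow> real^'n) \<Rightarrow> real^'n \<Rightarrow> real^'n"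
  where "covd G v Y x = Dif Y x v + G x v (Y x)"

text \<open>\<open>\<nabla>\<^sub>w V\<close> at \<open>u\<close>, for a vector field \<open>V\<close> along the map \<open>h\<close>.\<close>

definition covd_along :: "'n::finite christoffel \<Rightarrow> ('v::real_normed_vector \<Rightarrow> real^'n) \<Rightarrow>
    'v \<Rightarrow> ('v \<Rightarrow> real^'n) \<Rightarrow> 'v \<Rightarrow> real^'n"
  where "covd_along G h w V u = Dif V u w + G (h u) (Dif h u w) (V u)"

text \<open>The map \<open>h\<close> carries the connection \<open>G\<close> to \<open>G'\<close> at \<open>x\<close>. This is the transformation law of
  Christoffel symbols if \<open>h\<close> is a change of coordinates.\<close>

definition affine_at ::
    "'n::finite christoffel \<Rightarrow> 'n christoffel \<Rightarrow> (real^'n \<Rightarrow> real^'n) \<Rightarrow> real^'n \<Rightarrow> bool" where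
  "affine_at G G' h x \<longleftrightarrow> (\<forall>v w.
     Dif h x (G x v w) = Dif (\<lambda>y. Dif h y w) x v + G' (h x) (Dif h x v) (Dif h x w))"

text \<open>The last clause only fixes the irrelevant values of the symbols off the charts of the atlas,
  so that two connections are equal iff they are equal as functions.\<close>

definition affine_connection :: "('a, real^'n) chart set \<Rightarrow> ('a, 'n::finite) connection \<Rightarrow> bool" where
  "affine_connection A \<Gamma> \<longleftrightarrow>
     (\<forall>c\<in>A. \<forall>x\<in>chart_img c. bilinear (\<Gamma> c x)) \<and>
     (\<forall>c\<in>A. \<forall>v w. smooth_on (chart_img c) (\<lambda>x. \<Gamma> c x v w)) \<and>
     (\<forall>c\<in>A. \<forall>d\<in>A. \<forall>x\<in>loc_dom c d id. affine_at (\<Gamma> c) (\<Gamma> d) (loc_map c d id) x) \<and>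
     (\<forall>c x. c \<notin> A \<or> x \<notin> chart_img c \<longrightarrow> \<Gamma> c x = (\<lambda>v w. 0))"

definition torsion_free :: "('a, real^'n) chart set \<Rightarrow> ('a, 'n::finite) connection \<Rightarrow> bool"
  where "torsion_free A \<Gamma> \<longleftrightarrow> (\<forall>c\<in>A. \<forall>x\<in>chart_img c. \<forall>v w. \<Gamma> c x v w = \<Gamma> c x w v)"

text \<open>\<open>u\<^sup>i v\<^sup>j w\<^sup>p R\<^sub>i\<^sub>j\<^sub>p\<^sup>k\<close>, that is \<open>\<nabla>\<^sub>u \<nabla>\<^sub>v w - \<nabla>\<^sub>v \<nabla>\<^sub>u w\<close> for
  the commuting coordinate fields with constant components \<open>u\<close>, \<open>v\<close>, \<open>w\<close>.\<close>

definition curvature ::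
    "'n::finite christoffel \<Rightarrow> real^'n \<Rightarrow> real^'n \<Rightarrow> real^'n \<Rightarrow> real^'n \<Rightarrow> real^'n" where
  "curvature G x u v w =
     covd G u (covd G v (\<lambda>_. w)) x - covd G v (covd G u (\<lambda>_. w)) x"

text \<open>\<open>y\<^sup>i z\<^sup>j R\<^sub>p\<^sub>i\<^sub>j\<^sup>p\<close>.\<close>

definition ricci :: "'n::finite christoffel \<Rightarrow> real^'n \<Rightarrow> real^'n \<Rightarrow> real^'n \<Rightarrow> real"
  where "ricci G x y z = trace (matrix (\<lambda>u. curvature G x u y z))"

definition ricci_symmetric :: "('a, real^'n) chart set \<Rightarrow> ('a, 'n::finite) connection \<Rightarrow> bool" where
  "ricci_symmetric A \<Gamma> \<longleftrightarrow>
     (\<forall>c\<in>A. \<forall>x\<in>chart_img c. \<forall>y z. ricci (\<Gamma> c) x y z = ricci (\<Gamma> c) x z y)"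

definition ricci_antisymmetric ::
    "('a, real^'n) chart set \<Rightarrow> ('a, 'n::finite) connection \<Rightarrow> bool" where
  "ricci_antisymmetric A \<Gamma> \<longleftrightarrow>
     (\<forall>c\<in>A. \<forall>x\<in>chart_img c. \<forall>y z. ricci (\<Gamma> c) x y z = - ricci (\<Gamma> c) x z y)"

definition ricci_flat :: "('a, real^'n) chart set \<Rightarrow> ('a, 'n::finite) connection \<Rightarrow> bool"
  where "ricci_flat A \<Gamma> \<longleftrightarrow> (\<forall>c\<in>A. \<forall>x\<in>chart_img c. \<forall>y z. ricci (\<Gamma> c) x y z = 0)"

definition bracket :: "(real^'n \<Rightarrow> real^'n) \<Rightarrow> (real^'n \<Rightarrow> real^'n) \<Rightarrow> real^'n \<Rightarrow> real^'n::finite"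
  where "bracket Y Z x = Dif Z x (Y x) - Dif Y x (Z x)"

text \<open>The tensor \<open>[E, \<nabla>\<^sub>v w] - \<nabla>\<^bsub>[E,v]\<^esub> w - \<nabla>\<^sub>v [E, w]\<close> evaluated
  on the coordinate fields with constant components \<open>v\<close>, \<open>w\<close>.\<close>

definition lie_derivative_conn ::
    "'n::finite christoffel \<Rightarrow> (real^'n \<Rightarrow> real^'n) \<Rightarrow> real^'n \<Rightarrow> real^'n \<Rightarrow> real^'n \<Rightarrow> real^'n" where
  "lie_derivative_conn G E x v w =
     bracket E (covd G v (\<lambda>_. w)) x
     - covd G (bracket E (\<lambda>_. v) x) (\<lambda>_. w) x
     - covd G v (bracket E (\<lambda>_. w)) x"

definition E_invariant ::
    "('a, real^'n) chart set \<Rightarrow> ('a, 'n::finite) connection \<Rightarrow> ('a, 'n) vfield \<Rightarrow> bool" where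
  "E_invariant A \<Gamma> E \<longleftrightarrow>
     (\<forall>c\<in>A. \<forall>x\<in>chart_img c. \<forall>v w. lie_derivative_conn (\<Gamma> c) (E c) x v w = 0)"

text \<open>A section of the bundle of 1-densities over the domain of a chart is
  \<open>m \<bar>dx\<^sup>1 \<and> \<dots> \<and> dx\<^sup>n\<bar>\<close> for a function \<open>m\<close> of the coordinates, and
  \<open>\<nabla>\<^sub>i m = \<partial>\<^sub>i m - \<Gamma>\<^sub>i\<^sub>p\<^sup>p m\<close> is the induced connection.\<close>

definition density_covd ::
    "'n::finite christoffel \<Rightarrow> real^'n \<Rightarrow> (real^'n \<Rightarrow> real) \<Rightarrow> real^'n \<Rightarrow> real"
  where "density_covd G v m x = Dif m x v - trace (matrix (G x v)) * m x"

definition same_density_connection :: "('a, real^'n) chart set \<Rightarrow>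
    ('a, 'n::finite) connection \<Rightarrow> ('a, 'n) connection \<Rightarrow> bool" where
  "same_density_connection A \<Gamma> \<Gamma>' \<longleftrightarrow>
     (\<forall>c\<in>A. \<forall>m. smooth_on (chart_img c) m \<longrightarrow>
        (\<forall>x\<in>chart_img c. \<forall>v. density_covd (\<Gamma> c) v m x = density_covd (\<Gamma>' c) v m x))"


section \<open>Radiant structures\<close>

definition radiant_structure ::
    "('a, real^'n) chart set \<Rightarrow> ('a, 'n::finite) connection \<Rightarrow> ('a, 'n) vfield \<Rightarrow> bool" where
  "radiant_structure A \<Gamma> E \<longleftrightarrow>
     affine_connection A \<Gamma> \<and> torsion_free A \<Gamma> \<and> smooth_vector_field A E \<and>
     (\<forall>c\<in>A. \<forall>x\<in>chart_img c. \<forall>v. covd (\<Gamma> c) v (E c) x = v)"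

definition nonsingular :: "('a, real^'n) chart set \<Rightarrow> ('a, 'n::finite) vfield \<Rightarrow> bool"
  where "nonsingular A E \<longleftrightarrow> (\<forall>c\<in>A. \<forall>x\<in>chart_img c. E c x \<noteq> 0)"

text \<open>An immersion is totally geodesic if \<open>\<nabla>\<^sub>w Y\<close> is tangent to it whenever \<open>w\<close> and \<open>Y\<close> are.\<close>

definition totally_geodesic :: "('a, real^'n) chart set \<Rightarrow> ('a, 'n::finite) connection \<Rightarrow>
    ('s, 'v::real_normed_vector) chart set \<Rightarrow> ('s \<Rightarrow> 'a) \<Rightarrow> bool" where
  "totally_geodesic A \<Gamma> B f \<longleftrightarrow>
     (\<forall>b\<in>B. \<forall>c\<in>A. \<forall>Y. smooth_on (loc_dom b c f) Y \<longrightarrow>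
        (\<forall>u\<in>loc_dom b c f. \<forall>w.
           covd_along (\<Gamma> c) (loc_map b c f) w (\<lambda>t. Dif (loc_map b c f) t (Y t)) u
             \<in> range (Dif (loc_map b c f) u)))"

text \<open>The points of the abstract surface \<open>S\<close> are taken from the type of real numbers. This is no
  restriction: a surface has at most the cardinality of the continuum, so it is diffeomorphic to one
  whose set of points is a set of reals (with a topology unrelated to that of the reals).\<close>

definition planelike :: "'a topology \<Rightarrow> ('a, real^'n) chart set \<Rightarrow> ('a, 'n::finite) connection \<Rightarrow>
    ('a, 'n) vfield \<Rightarrow> real topology \<Rightarrow> (real, real^2) chart set \<Rightarrow> (real \<Rightarrow> 'a) \<Rightarrow> bool" where
  "planelike X A \<Gamma> E S B f \<longleftrightarrow>
     smooth_manifold S B \<and> smooth_immersion S B X A f \<and> totally_geodesic A \<Gamma> B f \<and>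
     (\<forall>b\<in>B. \<forall>c\<in>A. \<forall>u\<in>loc_dom b c f.
        E c (loc_map b c f u) \<in> range (Dif (loc_map b c f) u))"

definition conelike :: "'a topology \<Rightarrow> ('a, real^'n) chart set \<Rightarrow> ('a, 'n::finite) connection \<Rightarrow>
    ('a, 'n) vfield \<Rightarrow> bool" where
  "conelike X A \<Gamma> E \<longleftrightarrow>
     (\<forall>c\<in>A. \<forall>x\<in>chart_img c. \<forall>L. subspace L \<and> dim L = 2 \<and> E c x \<in> L \<longrightarrow>
        (\<exists>S B f. planelike X A \<Gamma> E S B f \<and>
           (\<exists>b\<in>B. \<exists>u\<in>loc_dom b c f.
              loc_map b c f u = x \<and> range (Dif (loc_map b c f) u) = L)))"

definition same_planelike_surfaces :: "'a topology \<Rightarrow> ('a, real^'n) chart set \<Rightarrow>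
    ('a, 'n::finite) connection \<Rightarrow> ('a, 'n) connection \<Rightarrow> ('a, 'n) vfield \<Rightarrow> bool" where
  "same_planelike_surfaces X A \<Gamma> \<Gamma>' E \<longleftrightarrow>
     (\<forall>S B f. planelike X A \<Gamma> E S B f \<longleftrightarrow> planelike X A \<Gamma>' E S B f)"

definition conelike_nonsingular_radiant :: "'a topology \<Rightarrow> ('a, real^'n) chart set \<Rightarrow>
    ('a, 'n::finite) connection \<Rightarrow> ('a, 'n) vfield \<Rightarrow> bool" where
  "conelike_nonsingular_radiant X A \<Gamma> E \<longleftrightarrow>
     radiant_structure A \<Gamma> E \<and> nonsingular A E \<and> conelike X A \<Gamma> E"

definition automorphism :: "'a topology \<Rightarrow> ('a, real^'n) chart set \<Rightarrow>
    ('a, 'n::finite) connection \<Rightarrow> ('a, 'n) vfield \<Rightarrow> ('a \<Rightarrow> 'a) \<Rightarrow> bool" where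
  "automorphism X A \<Gamma> E g \<longleftrightarrow> diffeomorphism X A g \<and>
     (\<forall>c\<in>A. \<forall>d\<in>A. \<forall>x\<in>loc_dom c d g.
        affine_at (\<Gamma> c) (\<Gamma> d) (loc_map c d g) x \<and>
        E d (loc_map c d g x) = Dif (loc_map c d g) x (E c x))"


section \<open>Lie groups and their actions\<close>

definition lie_group ::
    "('g, 'm) monoid_scheme \<Rightarrow> 'g topology \<Rightarrow> ('g, 'v::real_normed_vector) chart set \<Rightarrow> bool" where
  "lie_group G T B \<longleftrightarrow> group G \<and> topspace T = carrier G \<and> smooth_structure T B \<and>
     smooth_map (prod_topology T T) (prod_atlas B B) T B (\<lambda>(g, h). g \<otimes>\<^bsub>G\<^esub> h) \<and>
     smooth_map T B T B (\<lambda>g. inv\<^bsub>G\<^esub> g)"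

definition smooth_action ::
    "('g, 'm) monoid_scheme \<Rightarrow> 'g topology \<Rightarrow> ('g, 'v::real_normed_vector) chart set \<Rightarrow>
     'a topology \<Rightarrow> ('a, 'w::real_normed_vector) chart set \<Rightarrow> ('g \<Rightarrow> 'a \<Rightarrow> 'a) \<Rightarrow> bool" where
  "smooth_action G T B X A \<phi> \<longleftrightarrow> group_action G (topspace X) \<phi> \<and>
     smooth_map (prod_topology T X) (prod_atlas B A) X A (\<lambda>(g, p). \<phi> g p)"

definition acts_by_automorphisms ::
    "('g, 'm) monoid_scheme \<Rightarrow> 'g topology \<Rightarrow> ('g, 'v::real_normed_vector) chart set \<Rightarrow>
     'a topology \<Rightarrow> ('a, real^'n) chart set \<Rightarrow> ('g \<Rightarrow> 'a \<Rightarrow> 'a) \<Rightarrow>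
     ('a, 'n::finite) connection \<Rightarrow> ('a, 'n) vfield \<Rightarrow> bool" where
  "acts_by_automorphisms G T B X A \<phi> \<Gamma> E \<longleftrightarrow> smooth_action G T B X A \<phi> \<and>
     (\<forall>g\<in>carrier G. automorphism X A \<Gamma> E (\<phi> g))"


section \<open>The connections sought\<close>

definition antisymmetric_modification :: "'a topology \<Rightarrow> ('a, real^'n) chart set \<Rightarrow>
    ('a, 'n::finite) connection \<Rightarrow> ('a, 'n) vfield \<Rightarrow> ('a, 'n) connection \<Rightarrow> bool" where
  "antisymmetric_modification X A \<Gamma> E \<Gamma>' \<longleftrightarrow>
     E_invariant A \<Gamma>' E \<and> conelike_nonsingular_radiant X A \<Gamma>' E \<and> ricci_antisymmetric A \<Gamma>' \<and>
     same_planelike_surfaces X A \<Gamma> \<Gamma>' E \<and> same_density_connection A \<Gamma> \<Gamma>'"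

definition flat_modification :: "'a topology \<Rightarrow> ('a, real^'n) chart set \<Rightarrow>
    ('a, 'n::finite) connection \<Rightarrow> ('a, 'n) vfield \<Rightarrow> ('a, 'n) connection \<Rightarrow> bool" where
  "flat_modification X A \<Gamma> E \<Gamma>' \<longleftrightarrow>
     ricci_flat A \<Gamma>' \<and> E_invariant A \<Gamma>' E \<and> conelike_nonsingular_radiant X A \<Gamma>' E \<and>
     same_planelike_surfaces X A \<Gamma> \<Gamma>' E \<and> same_density_connection A \<Gamma> \<Gamma>'"

end

theory Submission
  imports Defs
begin

text \<open>Since \<open>\<nabla>\<^sub>i E\<^sup>j = \<delta>\<^sub>i\<^sup>j\<close>, the Lie derivative of \<open>\<nabla>\<close> along \<open>E\<close> is \<open>E\<^sup>p R\<^sub>p\<^sub>i\<^sub>j\<^sup>k\<close>. Planelike surfaces force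
  this symmetric tensor to map \<open>(v, v)\<close> into the span of \<open>E\<close> and \<open>v\<close>; as its trace
  vanishes by hypothesis, algebra gives \<open>E\<^sup>p R\<^sub>p\<^sub>i\<^sub>j\<^sup>k = a\<^sub>i\<^sub>j E\<^sup>k\<close>. The same algebra shows that two connections
  with the same planelike surfaces and the same connection on densities differ by \<open>P\<^sub>i\<^sub>j E\<^sup>k\<close> with \<open>P\<close> symmetric
  and \<open>P(E,\<hyphen>) = 0\<close>; conversely, adding such a term changes neither of the two. It replaces \<open>a\<close> by
  \<open>a + L\<^sub>E P\<close> and the Ricci tensor by \<open>Ric + L\<^sub>E P + (n - 2) P\<close>. Hence invariance together with
  antisymmetry of the Ricci tensor forces \<open>(n - 2) P = a - Ric\<^sub>s\<^sub>y\<^sub>m\<close>. That this \<open>P\<close> does satisfy \<open>L\<^sub>E P = - a\<close>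
  is the second Bianchi identity contracted with \<open>E\<close> and traced. The new Ricci tensor is the
  antisymmetric part of the old one, and \<open>P\<close> is natural, hence preserved by
  automorphisms.\<close>

section \<open>Calculus of smooth functions\<close>

text \<open>The same algebra is applied to two tensors: the curvature contracted with
  \<open>E\<close>, and the difference of two candidate connections. A planelike surface only
  controls the diagonal values \<open>D v v\<close>, and leaves an unwanted multiple of
  \<open>v\<close> in them. This multiple is removed by a trace condition. For the curvature the
  trace of \<open>D v\<close> is, up to sign, the one-form assumed to vanish; for two connections
  its vanishing is the equality of the induced connections on densities. One tensor has to satisfy
  two equations, invariance and antisymmetry of the Ricci tensor. They are compatible because the
  same number \<open>n - 2\<close>, with \<open>n\<close> the dimension, appears when the modified
  curvature is traced and when the Bianchi identity is traced; \<open>n > 2\<close> allows dividing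
  by it. All computations take place in charts. A change of coordinates is the local expression of
  the identity, so independence of the chart is a case of naturality under automorphisms.\<close>

lemma Dif_eqI: "(f has_derivative f') (at x) \<Longrightarrow> Dif f x = f'"
  by (rule frechet_derivative_at[symmetric])

lemma has_derivative_Dif: "f differentiable at x \<Longrightarrow> (f has_derivative Dif f x) (at x)"
  by (simp add: frechet_derivative_works)

text \<open>\<open>frechet_derivative\<close> is a choice that depends only on the predicate
  \<open>has_derivative\<close>, and this depends only on the germ of the map. Hence the equality
  also holds where neither map is differentiable.\<close>

lemma Dif_cong:
  assumes "open S" "x \<in> S" "\<And>y. y \<in> S \<Longrightarrow> f y = g y"
  shows "Dif f x = Dif g x"
proof -
  have "(f has_derivative f') (at x) \<longleftrightarrow> (g has_derivative f') (at x)" for f'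
    using has_derivative_transform_within_open[of f f' x UNIV S g] has_derivative_transform_within_open[of g f' x UNIV S f] assms
    by auto
  then show ?thesis
    by (simp add: frechet_derivative_def)
qed

lemma differentiable_cong_open:
  assumes "f differentiable at x" "open S" "x \<in> S" "\<And>y. y \<in> S \<Longrightarrow> f y = g y"
  shows "g differentiable at x"
proof -
  obtain f' where "(f has_derivative f') (at x)"
    using assms(1) by (auto simp: differentiable_def)
  from has_derivative_transform_within_open[OF this assms(2-4)] show ?thesis
    by (rule differentiableI)
qed

lemma Ck_on_differentiable_at:
  "Ck_on (Suc k) S f \<Longrightarrow> open S \<Longrightarrow> x \<in> S \<Longrightarrow> f differentiable at x"
  by (simp add: differentiable_on_eq_differentiable_at)

lemma Ck_on_cong:
  assumes "open S" "\<And>x. x \<in> S \<Longrightarrow> f x = g x" "Ck_on k S f"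
  shows "Ck_on k S g"
  using assms(2,3)
proof (induction k arbitrary: f g)
  case 0
  then show ?case using continuous_on_cong by auto
next
  case (Suc k)
  have "g differentiable at x" if "x \<in> S" for x
    using Ck_on_differentiable_at[OF Suc.prems(2) assms(1) that] assms(1) that Suc.prems(1)
    by (rule differentiable_cong_open)
  then have "g differentiable_on S"
    by (simp add: differentiable_at_imp_differentiable_on)
  moreover have "Ck_on k S (\<lambda>x. Dif g x v)" for v
  proof (rule Suc.IH)
    show "Ck_on k S (\<lambda>x. Dif f x v)" using Suc.prems by simp
    show "Dif f x v = Dif g x v" if "x \<in> S" for x
      using Dif_cong[OF assms(1) that, of f g] Suc.prems(1) by simp
  qed
  ultimately show ?case by simp
qed

text \<open>The recursion of \<open>Ck_on\<close> speaks of the chosen derivative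
  \<open>Dif f x\<close>. Here any explicit formula may take its place, so that closure properties
  follow from the usual differentiation rules by induction on the order.\<close>

lemma Ck_on_SucI:
  assumes "open S" "\<And>x. x \<in> S \<Longrightarrow> (f has_derivative f' x) (at x)"
    and "\<And>v. Ck_on k S (\<lambda>x. f' x v)"
  shows "Ck_on (Suc k) S f"
proof -
  have "f differentiable at x" if "x \<in> S" for x
    using assms(2)[OF that] by (rule differentiableI)
  then have "f differentiable_on S"
    by (simp add: differentiable_at_imp_differentiable_on)
  moreover have "Ck_on k S (\<lambda>x. Dif f x v)" for v
  proof (rule Ck_on_cong[OF assms(1) _ assms(3)])
    show "f' x v = Dif f x v" if "x \<in> S" for x
      by (simp add: Dif_eqI[OF assms(2)[OF that]])
  qed
  ultimately show ?thesis by simp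
qed

lemma Ck_on_Suc_imp: "Ck_on (Suc k) S f \<Longrightarrow> Ck_on k S f"
  by (induction k arbitrary: f) (auto simp: differentiable_imp_continuous_on)

lemma Ck_on_const: "Ck_on k S (\<lambda>_. c)"
  by (induction k arbitrary: c) (auto simp: differentiable_on_const)

lemma Ck_on_bounded_linear:
  assumes "open S" "bounded_linear F" "Ck_on k S f"
  shows "Ck_on k S (\<lambda>x. F (f x))"
  using assms(3)
proof (induction k arbitrary: f)
  case 0
  then show ?case using bounded_linear.continuous_on[OF assms(2)] by simp
next
  case (Suc k)
  show ?case
  proof (rule Ck_on_SucI[OF assms(1)])
    show "((\<lambda>x. F (f x)) has_derivative (\<lambda>v. F (Dif f x v))) (at x)" if "x \<in> S" for x
      using Ck_on_differentiable_at[OF Suc.prems assms(1) that]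
      by (intro bounded_linear.has_derivative[OF assms(2)] has_derivative_Dif)
    show "Ck_on k S (\<lambda>x. F (Dif f x v))" for v
      using Suc by simp
  qed
qed

lemma Ck_on_add:
  assumes "open S" "Ck_on k S f" "Ck_on k S g"
  shows "Ck_on k S (\<lambda>x. f x + g x)"
  using assms(2,3)
proof (induction k arbitrary: f g)
  case 0
  then show ?case by (simp add: continuous_on_add)
next
  case (Suc k)
  show ?case
  proof (rule Ck_on_SucI[OF assms(1)])
    show "((\<lambda>x. f x + g x) has_derivative (\<lambda>v. Dif f x v + Dif g x v)) (at x)" if "x \<in> S" for x
      using Ck_on_differentiable_at[OF Suc.prems(1) assms(1) that]
        Ck_on_differentiable_at[OF Suc.prems(2) assms(1) that]
      by (intro has_derivative_add has_derivative_Dif)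
    show "Ck_on k S (\<lambda>x. Dif f x v + Dif g x v)" for v
      using Suc by simp
  qed
qed

lemma Ck_on_sum:
  assumes "open S" "\<And>i. i \<in> I \<Longrightarrow> Ck_on k S (f i)"
  shows "Ck_on k S (\<lambda>x. \<Sum>i\<in>I. f i x)"
  using assms(2)
proof (induction I rule: infinite_finite_induct)
  case (insert i I)
  then show ?case by (simp add: Ck_on_add[OF assms(1)])
qed (simp_all add: Ck_on_const)

lemma Ck_on_bilinear:
  assumes "open S" "bounded_bilinear p" "Ck_on k S f" "Ck_on k S g"
  shows "Ck_on k S (\<lambda>x. p (f x) (g x))"
  using assms(3,4)
proof (induction k arbitrary: f g)
  case 0
  then show ?case by (simp add: bounded_bilinear.continuous_on[OF assms(2)])
next
  case (Suc k)
  show ?case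
  proof (rule Ck_on_SucI[OF assms(1)])
    show "((\<lambda>x. p (f x) (g x)) has_derivative (\<lambda>v. p (f x) (Dif g x v) + p (Dif f x v) (g x))) (at x)"
      if "x \<in> S" for x
      using Ck_on_differentiable_at[OF Suc.prems(1) assms(1) that]
        Ck_on_differentiable_at[OF Suc.prems(2) assms(1) that]
      by (intro bounded_bilinear.FDERIV[OF assms(2)] has_derivative_Dif)
    show "Ck_on k S (\<lambda>x. p (f x) (Dif g x v) + p (Dif f x v) (g x))" for v
      using Suc.IH Suc.prems Ck_on_Suc_imp[OF Suc.prems(1)] Ck_on_Suc_imp[OF Suc.prems(2)]
      by (intro Ck_on_add[OF assms(1)]) auto
  qed
qed

text \<open>The reciprocal reappears in its own derivative, but there it is needed only one order
  lower, which the induction hypothesis supplies.\<close>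

lemma Ck_on_inverse:
  fixes f :: "'v::real_normed_vector \<Rightarrow> real"
  assumes "open S" "Ck_on k S f" and nz: "\<And>x. x \<in> S \<Longrightarrow> f x \<noteq> 0"
  shows "Ck_on k S (\<lambda>x. inverse (f x))"
  using assms(2)
proof (induction k)
  case 0
  then show ?case using nz by (simp add: continuous_on_inverse)
next
  case (Suc k)
  have mult: "Ck_on k S (\<lambda>x. g x * h x)" if "Ck_on k S g" "Ck_on k S h" for g h :: "'v \<Rightarrow> real"
    using Ck_on_bilinear[OF assms(1) bounded_bilinear_mult that] .
  show ?case
  proof (rule Ck_on_SucI[OF assms(1)])
    show "((\<lambda>x. inverse (f x)) has_derivative (\<lambda>v. - (inverse (f x) * Dif f x v * inverse (f x)))) (at x)"
      if "x \<in> S" for x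
      using Ck_on_differentiable_at[OF Suc.prems assms(1) that] nz[OF that]
      by (intro Deriv.has_derivative_inverse has_derivative_Dif)
    show "Ck_on k S (\<lambda>x. - (inverse (f x) * Dif f x v * inverse (f x)))" for v
      using Suc Ck_on_Suc_imp[OF Suc.prems]
      by (intro Ck_on_bounded_linear[OF assms(1) bounded_linear_minus[OF bounded_linear_ident]] mult) auto
  qed
qed

lemma smooth_on_cong: "open S \<Longrightarrow> (\<And>x. x \<in> S \<Longrightarrow> f x = g x) \<Longrightarrow> smooth_on S f \<Longrightarrow> smooth_on S g"
  unfolding smooth_on_def using Ck_on_cong[of S f g] by simp

lemma smooth_on_const: "smooth_on S (\<lambda>_. c)"
  by (simp add: smooth_on_def Ck_on_const)

lemma smooth_on_differentiable_at: "smooth_on S f \<Longrightarrow> open S \<Longrightarrow> x \<in> S \<Longrightarrow> f differentiable at x"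
  unfolding smooth_on_def using Ck_on_differentiable_at[of 0 S f x] by (metis (no_types))

lemma smooth_on_Dif: "smooth_on S f \<Longrightarrow> smooth_on S (\<lambda>x. Dif f x v)"
  unfolding smooth_on_def
proof
  fix k assume "\<forall>k. Ck_on k S f"
  then have "Ck_on (Suc k) S f" by blast
  then show "Ck_on k S (\<lambda>x. Dif f x v)" by simp
qed

lemma smooth_on_bounded_linear:
  "open S \<Longrightarrow> bounded_linear F \<Longrightarrow> smooth_on S f \<Longrightarrow> smooth_on S (\<lambda>x. F (f x))"
  by (simp add: smooth_on_def Ck_on_bounded_linear)

lemma smooth_on_add:
  "open S \<Longrightarrow> smooth_on S f \<Longrightarrow> smooth_on S g \<Longrightarrow> smooth_on S (\<lambda>x. f x + g x)"
  by (simp add: smooth_on_def Ck_on_add)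

lemma smooth_on_sum:
  "open S \<Longrightarrow> (\<And>i. i \<in> I \<Longrightarrow> smooth_on S (f i)) \<Longrightarrow> smooth_on S (\<lambda>x. \<Sum>i\<in>I. f i x)"
  by (simp add: smooth_on_def Ck_on_sum)

lemma smooth_on_bilinear:
  "open S \<Longrightarrow> bounded_bilinear p \<Longrightarrow> smooth_on S f \<Longrightarrow> smooth_on S g \<Longrightarrow> smooth_on S (\<lambda>x. p (f x) (g x))"
  by (simp add: smooth_on_def Ck_on_bilinear)

lemma smooth_on_inverse:
  fixes f :: "'v::real_normed_vector \<Rightarrow> real"
  shows "open S \<Longrightarrow> smooth_on S f \<Longrightarrow> (\<And>x. x \<in> S \<Longrightarrow> f x \<noteq> 0) \<Longrightarrow> smooth_on S (\<lambda>x. inverse (f x))"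
  by (simp add: smooth_on_def Ck_on_inverse)

lemmas smooth_on_scaleR = smooth_on_bilinear[OF _ bounded_bilinear_scaleR]
lemmas smooth_on_mult = smooth_on_bilinear[OF _ bounded_bilinear_mult]
lemmas smooth_on_inner = smooth_on_bilinear[OF _ bounded_bilinear_inner]
lemmas smooth_on_minus = smooth_on_bounded_linear[OF _ bounded_linear_minus[OF bounded_linear_ident]]

lemma smooth_on_diff:
  "open S \<Longrightarrow> smooth_on S f \<Longrightarrow> smooth_on S g \<Longrightarrow> smooth_on S (\<lambda>x. f x - g x)"
  using smooth_on_add[of S f "\<lambda>x. - g x"] smooth_on_minus[of S g] by simp

lemma smooth_on_divide:
  fixes f :: "'v::real_normed_vector \<Rightarrow> real"
  shows "open S \<Longrightarrow> smooth_on S f \<Longrightarrow> smooth_on S g \<Longrightarrow> (\<And>x. x \<in> S \<Longrightarrow> g x \<noteq> 0) \<Longrightarrow> smooth_on S (\<lambda>x. f x / g x)"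
  unfolding divide_inverse by (intro smooth_on_mult smooth_on_inverse)

lemma linear_Dif: "smooth_on S f \<Longrightarrow> open S \<Longrightarrow> x \<in> S \<Longrightarrow> linear (Dif f x)"
  using smooth_on_differentiable_at linear_frechet_derivative by blast

subsection \<open>Fields of linear maps\<close>

lemma linear_expand_Basis:
  fixes F :: "'a::euclidean_space \<Rightarrow> 'b::real_vector"
  assumes "linear F"
  shows "F v = (\<Sum>b\<in>Basis. (v \<bullet> b) *\<^sub>R F b)"
proof -
  have "F v = F (\<Sum>b\<in>Basis. (v \<bullet> b) *\<^sub>R b)"
    by (simp add: euclidean_representation)
  also have "\<dots> = (\<Sum>b\<in>Basis. (v \<bullet> b) *\<^sub>R F b)"
    by (simp add: linear_sum[OF assms] linear_scale[OF assms])
  finally show ?thesis .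
qed

text \<open>Fields such as Christoffel symbols are given as smooth at constant arguments only.
  Expanding \<open>V\<close> in a basis reduces a varying argument to constant ones.\<close>

lemma smooth_on_linear_field:
  fixes V :: "'v::real_normed_vector \<Rightarrow> 'a::euclidean_space"
  assumes "open S" "\<And>x. x \<in> S \<Longrightarrow> linear (B x)" "\<And>v. smooth_on S (\<lambda>x. B x v)" "smooth_on S V"
  shows "smooth_on S (\<lambda>x. B x (V x))"
proof (rule smooth_on_cong[OF assms(1)])
  show "smooth_on S (\<lambda>x. \<Sum>b\<in>Basis. (V x \<bullet> b) *\<^sub>R B x b)"
    using assms by (intro smooth_on_sum smooth_on_scaleR smooth_on_inner smooth_on_const)
qed (rule linear_expand_Basis[OF assms(2), symmetric])

lemma has_derivative_linear_field:
  fixes V :: "'v::real_normed_vector \<Rightarrow> 'a::euclidean_space"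
  assumes S: "open S" "x \<in> S" and lin: "\<And>y. y \<in> S \<Longrightarrow> linear (B y)"
    and B: "\<And>v. ((\<lambda>y. B y v) has_derivative B' v) (at x)"
    and V: "(V has_derivative V') (at x)"
  shows "((\<lambda>y. B y (V y)) has_derivative (\<lambda>u. B' (V x) u + B x (V' u))) (at x)"
proof -
  \<comment> \<open>Linearity of \<open>B' v u\<close> in \<open>v\<close> is not assumed; it
    follows from the uniqueness of derivatives.\<close>
  have B': "B' v u = (\<Sum>b\<in>Basis. (v \<bullet> b) *\<^sub>R B' b u)" for u v
  proof -
    have "((\<lambda>y. \<Sum>b\<in>Basis. (v \<bullet> b) *\<^sub>R B y b) has_derivative (\<lambda>u. \<Sum>b\<in>Basis. (v \<bullet> b) *\<^sub>R B' b u)) (at x)"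
      using B by (intro derivative_intros)
    then have "((\<lambda>y. B y v) has_derivative (\<lambda>u. \<Sum>b\<in>Basis. (v \<bullet> b) *\<^sub>R B' b u)) (at x)"
      using S by (rule has_derivative_transform_within_open) (rule linear_expand_Basis[OF lin, symmetric])
    from has_derivative_unique[OF B[of v] this] show ?thesis
      by (rule fun_cong)
  qed
  have "((\<lambda>y. \<Sum>b\<in>Basis. (V y \<bullet> b) *\<^sub>R B y b) has_derivative
      (\<lambda>u. \<Sum>b\<in>Basis. (V x \<bullet> b) *\<^sub>R B' b u + (V' u \<bullet> b) *\<^sub>R B x b)) (at x)"
    using B V by (intro derivative_intros) auto
  moreover have "(\<Sum>b\<in>Basis. (V x \<bullet> b) *\<^sub>R B' b u + (V' u \<bullet> b) *\<^sub>R B x b) = B' (V x) u + B x (V' u)" for u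
    unfolding B'[of "V x" u] linear_expand_Basis[OF lin[OF S(2)], of "V' u"] by (rule sum.distrib)
  ultimately have "((\<lambda>y. \<Sum>b\<in>Basis. (V y \<bullet> b) *\<^sub>R B y b) has_derivative (\<lambda>u. B' (V x) u + B x (V' u))) (at x)"
    by (simp only:)
  then show ?thesis
    using S by (rule has_derivative_transform_within_open) (rule linear_expand_Basis[OF lin, symmetric])
qed

lemma linear_Dif_field:
  assumes S: "open S" "x \<in> S" and lin: "\<And>y. y \<in> S \<Longrightarrow> linear (B y)"
    and B: "\<And>v. (\<lambda>y. B y v) differentiable at x"
  shows "linear (\<lambda>v. Dif (\<lambda>y. B y v) x u)"
proof (rule linearI)
  fix v w and c :: real
  note D = has_derivative_Dif[OF B]
  have "Dif (\<lambda>y. B y (v + w)) x = Dif (\<lambda>y. B y v + B y w) x"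
    by (rule Dif_cong[OF S]) (rule linear_add[OF lin])
  then show "Dif (\<lambda>y. B y (v + w)) x u = Dif (\<lambda>y. B y v) x u + Dif (\<lambda>y. B y w) x u"
    by (simp add: Dif_eqI[OF has_derivative_add[OF D D]])
  have "Dif (\<lambda>y. B y (c *\<^sub>R v)) x = Dif (\<lambda>y. c *\<^sub>R B y v) x"
    by (rule Dif_cong[OF S]) (rule linear_scale[OF lin])
  then show "Dif (\<lambda>y. B y (c *\<^sub>R v)) x u = c *\<^sub>R Dif (\<lambda>y. B y v) x u"
    by (simp add: Dif_eqI[OF has_derivative_scaleR_right[OF D]])
qed

lemma has_derivative_bilinear_field:
  fixes V :: "'v::real_normed_vector \<Rightarrow> 'a::euclidean_space" and W :: "'v \<Rightarrow> 'b::euclidean_space"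
  assumes S: "open S" "x \<in> S" and lin: "\<And>y. y \<in> S \<Longrightarrow> bilinear (B y)"
    and B: "\<And>v w. ((\<lambda>y. B y v w) has_derivative B' v w) (at x)"
    and V: "(V has_derivative V') (at x)" and W: "(W has_derivative W') (at x)"
  shows "((\<lambda>y. B y (V y) (W y)) has_derivative
    (\<lambda>u. B' (V x) (W x) u + B x (V' u) (W x) + B x (V x) (W' u))) (at x)"
proof -
  have l1: "linear (\<lambda>v. B y v w)" and l2: "linear (\<lambda>w. B y v w)" if "y \<in> S" for y v w
    using lin[OF that] by (simp_all add: bilinear_def)
  have 1: "((\<lambda>y. B y (V y) w) has_derivative (\<lambda>u. B' (V x) w u + B x (V' u) w)) (at x)" for w
    using has_derivative_linear_field[OF S l1 B V] .
  show ?thesis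
    using has_derivative_linear_field[OF S l2 1 W] .
qed

subsection \<open>Symmetry of second derivatives\<close>

text \<open>Both mixed derivatives are limits of the second difference of \<open>f\<close> over the parallelogram
  spanned by \<open>s u\<close> and \<open>s v\<close>, divided by \<open>s\<^sup>2\<close>.\<close>

lemma has_real_derivative_line:
  assumes "(f has_derivative F) (at (y + a *\<^sub>R u))"
  shows "((\<lambda>t. f (y + t *\<^sub>R u)) has_real_derivative F u) (at a)"
proof -
  have "((\<lambda>t. y + t *\<^sub>R u) has_derivative (\<lambda>h. h *\<^sub>R u)) (at a)"
    by (auto intro!: derivative_eq_intros)
  from has_derivative_compose[OF this assms]
  have "((\<lambda>t. f (y + t *\<^sub>R u)) has_derivative (\<lambda>h. F (h *\<^sub>R u))) (at a)" .
  then show ?thesis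
    unfolding has_field_derivative_def
    using linear_scale[OF has_derivative_linear[OF assms]] by (simp add: mult_commute_abs)
qed

lemma second_difference:
  fixes f :: "'v::real_normed_vector \<Rightarrow> real"
  assumes "Ck_on 2 S f" "open S" "s > 0"
    and sq: "\<And>a b. 0 \<le> a \<Longrightarrow> a \<le> s \<Longrightarrow> 0 \<le> b \<Longrightarrow> b \<le> s \<Longrightarrow> x + a *\<^sub>R u + b *\<^sub>R v \<in> S"
  shows "\<exists>a b. 0 \<le> a \<and> a \<le> s \<and> 0 \<le> b \<and> b \<le> s \<and>
    f (x + s *\<^sub>R u + s *\<^sub>R v) - f (x + s *\<^sub>R u) - f (x + s *\<^sub>R v) + f x
      = s * s * Dif (\<lambda>y. Dif f y u) (x + a *\<^sub>R u + b *\<^sub>R v) v"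
proof -
  have d1: "(f has_derivative Dif f y) (at y)" if "y \<in> S" for y
    using Ck_on_differentiable_at[of 1 S f y] assms(1,2) that
    by (intro has_derivative_Dif) (simp add: numeral_2_eq_2)
  have d2: "((\<lambda>y. Dif f y u) has_derivative Dif (\<lambda>y. Dif f y u) y) (at y)" if "y \<in> S" for y
    using Ck_on_differentiable_at[of 0 S "\<lambda>y. Dif f y u" y] assms(1,2) that
    by (intro has_derivative_Dif) (simp add: numeral_2_eq_2)
  \<comment> \<open>The mean value theorem is applied twice: along \<open>u\<close> to this
    difference in direction \<open>v\<close>, then along \<open>v\<close> to the derivative
    \<open>k\<close> in direction \<open>u\<close>.\<close>
  define g where "g a = f (x + s *\<^sub>R v + a *\<^sub>R u) - f (x + a *\<^sub>R u)" for a
  have g: "(g has_real_derivative Dif f (x + a *\<^sub>R u + s *\<^sub>R v) u - Dif f (x + a *\<^sub>R u) u) (at a)"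
    if "0 \<le> a" "a \<le> s" for a
  proof -
    have m: "x + s *\<^sub>R v + a *\<^sub>R u \<in> S" "x + a *\<^sub>R u \<in> S"
      using sq[of a s] sq[of a 0] that assms(3) by (auto simp: algebra_simps)
    show ?thesis
      unfolding g_def
      using has_real_derivative_line[OF d1[OF m(1)]] has_real_derivative_line[OF d1[OF m(2)]]
      by (auto intro!: derivative_eq_intros simp: algebra_simps)
  qed
  obtain a where a: "0 < a" "a < s" "g s - g 0 = (s - 0) * (Dif f (x + a *\<^sub>R u + s *\<^sub>R v) u - Dif f (x + a *\<^sub>R u) u)"
    using MVT2[OF assms(3) g] by blast
  define k where "k b = Dif f (x + a *\<^sub>R u + b *\<^sub>R v) u" for b
  have k: "(k has_real_derivative Dif (\<lambda>y. Dif f y u) (x + a *\<^sub>R u + b *\<^sub>R v) v) (at b)"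
    if "0 \<le> b" "b \<le> s" for b
  proof -
    have m: "x + a *\<^sub>R u + b *\<^sub>R v \<in> S"
      using sq[of a b] that a by auto
    show ?thesis
      unfolding k_def using has_real_derivative_line[OF d2[OF m]] .
  qed
  obtain b where b: "0 < b" "b < s" "k s - k 0 = (s - 0) * Dif (\<lambda>y. Dif f y u) (x + a *\<^sub>R u + b *\<^sub>R v) v"
    using MVT2[OF assms(3) k] by blast
  have "f (x + s *\<^sub>R u + s *\<^sub>R v) - f (x + s *\<^sub>R u) - f (x + s *\<^sub>R v) + f x = g s - g 0"
    by (simp add: g_def algebra_simps)
  also have "\<dots> = s * (k s - k 0)"
    using a by (simp add: k_def)
  finally show ?thesis
    using a b by (intro exI[of _ a] exI[of _ b]) auto
qed

lemma Dif_Dif_commute_real: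
  fixes f :: "'v::real_normed_vector \<Rightarrow> real"
  assumes "Ck_on 2 S f" "open S" "x \<in> S"
  shows "Dif (\<lambda>y. Dif f y u) x v = Dif (\<lambda>y. Dif f y v) x u"
proof -
  obtain r where r: "r > 0" "ball x r \<subseteq> S"
    using assms openE by blast
  define A where "A y = Dif (\<lambda>y. Dif f y u) y v" for y
  define B where "B y = Dif (\<lambda>y. Dif f y v) y u" for y
  have cont: "isCont A x" "isCont B x"
    using assms unfolding A_def B_def
    by (auto simp: numeral_2_eq_2 continuous_on_eq_continuous_at)
  have close: "\<exists>y z. dist y x < e \<and> dist z x < e \<and> A y = B z" if e: "0 < e" "e \<le> r" for e
  proof -
    \<comment> \<open>The parallelogram with sides \<open>s u\<close> and \<open>s v\<close> then
      stays within distance \<open>e\<close> of \<open>x\<close>. The summand 1 keeps the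
      denominator positive if both vectors vanish.\<close>
    define s where "s = e / (2 * (norm u + norm v + 1))"
    have den: "norm u + norm v + 1 > 0" by (simp add: add_nonneg_pos)
    have s: "s > 0" using e den by (simp add: s_def)
    have "s * (norm u + norm v + 1) = e / 2"
      using den by (simp add: s_def divide_simps)
    then have s2: "s * norm u + s * norm v < e"
      using s e by (simp add: algebra_simps)
    have near: "dist (x + a *\<^sub>R u + b *\<^sub>R v) x < e" if "0 \<le> a" "a \<le> s" "0 \<le> b" "b \<le> s" for a b
    proof -
      have "dist (x + a *\<^sub>R u + b *\<^sub>R v) x = norm (a *\<^sub>R u + b *\<^sub>R v)"
        by (simp add: dist_norm)
      also have "\<dots> \<le> a * norm u + b * norm v"
        using norm_triangle_ineq[of "a *\<^sub>R u" "b *\<^sub>R v"] that by simp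
      also have "\<dots> \<le> s * norm u + s * norm v"
        using that by (intro add_mono mult_right_mono) auto
      finally show ?thesis using s2 by linarith
    qed
    have sub: "x + a *\<^sub>R u + b *\<^sub>R v \<in> S" if "0 \<le> a" "a \<le> s" "0 \<le> b" "b \<le> s" for a b
      using near[OF that] e r by (auto simp: dist_commute)
    then have sub': "x + a *\<^sub>R v + b *\<^sub>R u \<in> S" if "0 \<le> a" "a \<le> s" "0 \<le> b" "b \<le> s" for a b
      using sub[of b a] that by (simp add: add.assoc add.commute[of "a *\<^sub>R v"])
    obtain a b where ab: "0 \<le> a" "a \<le> s" "0 \<le> b" "b \<le> s"
      "f (x + s *\<^sub>R u + s *\<^sub>R v) - f (x + s *\<^sub>R u) - f (x + s *\<^sub>R v) + f x = s * s * A (x + a *\<^sub>R u + b *\<^sub>R v)"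
      using second_difference[OF assms(1,2) s sub] unfolding A_def by blast
    obtain c d where cd: "0 \<le> c" "c \<le> s" "0 \<le> d" "d \<le> s"
      "f (x + s *\<^sub>R v + s *\<^sub>R u) - f (x + s *\<^sub>R v) - f (x + s *\<^sub>R u) + f x = s * s * B (x + c *\<^sub>R v + d *\<^sub>R u)"
      using second_difference[OF assms(1,2) s sub'] unfolding B_def by blast
    have "s * s * A (x + a *\<^sub>R u + b *\<^sub>R v) = s * s * B (x + c *\<^sub>R v + d *\<^sub>R u)"
      unfolding ab(5)[symmetric] cd(5)[symmetric] by (simp add: algebra_simps)
    then have "A (x + a *\<^sub>R u + b *\<^sub>R v) = B (x + c *\<^sub>R v + d *\<^sub>R u)"
      using s by simp
    moreover have "dist (x + c *\<^sub>R v + d *\<^sub>R u) x < e"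
      using near[of d c] cd by (simp add: add.assoc add.commute[of "c *\<^sub>R v"])
    ultimately show ?thesis
      using near[OF ab(1-4)] by blast
  qed
  have "\<bar>A x - B x\<bar> < e" if e: "e > 0" for e
  proof -
    obtain d1 where d1: "d1 > 0" "\<And>y. dist y x < d1 \<Longrightarrow> dist (A y) (A x) < e / 2"
      using cont(1)[unfolded continuous_at_eps_delta, rule_format, OF half_gt_zero[OF e]] by blast
    obtain d2 where d2: "d2 > 0" "\<And>y. dist y x < d2 \<Longrightarrow> dist (B y) (B x) < e / 2"
      using cont(2)[unfolded continuous_at_eps_delta, rule_format, OF half_gt_zero[OF e]] by blast
    obtain y z where yz: "dist y x < min r (min d1 d2)" "dist z x < min r (min d1 d2)" "A y = B z"
      using close[of "min r (min d1 d2)"] d1 d2 r by auto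
    have "dist (A y) (A x) < e / 2" "dist (B z) (B x) < e / 2"
      using d1(2)[of y] d2(2)[of z] yz(1,2) by simp_all
    then show ?thesis using yz(3) unfolding dist_real_def by linarith
  qed
  from this[of "\<bar>A x - B x\<bar>"] have "A x = B x"
    by force
  then show ?thesis by (simp add: A_def B_def)
qed

lemma Dif_Dif_commute:
  fixes f :: "'v::real_normed_vector \<Rightarrow> 'w::euclidean_space"
  assumes "smooth_on S f" "open S" "x \<in> S"
  shows "Dif (\<lambda>y. Dif f y u) x v = Dif (\<lambda>y. Dif f y v) x u"
proof (rule euclidean_eqI)
  fix b :: 'w assume "b \<in> Basis"
  have *: "Dif (\<lambda>y. g y \<bullet> b) y w = Dif g y w \<bullet> b"
    if "smooth_on S g" "y \<in> S" for g :: "'v \<Rightarrow> 'w" and y w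
    using smooth_on_differentiable_at[OF that(1) assms(2) that(2)]
    by (auto intro!: Dif_eqI[THEN fun_cong] derivative_eq_intros has_derivative_Dif)
  have "smooth_on S (\<lambda>y. f y \<bullet> b)"
    by (intro smooth_on_inner assms smooth_on_const)
  then have "Ck_on 2 S (\<lambda>y. f y \<bullet> b)"
    by (simp add: smooth_on_def)
  then have "Dif (\<lambda>y. Dif (\<lambda>y. f y \<bullet> b) y u) x v = Dif (\<lambda>y. Dif (\<lambda>y. f y \<bullet> b) y v) x u"
    using assms(2,3) by (rule Dif_Dif_commute_real)
  moreover have "Dif (\<lambda>y. Dif (\<lambda>y. f y \<bullet> b) y w) x = Dif (\<lambda>y. Dif f y w \<bullet> b) x" for w
    using assms(2,3) by (rule Dif_cong) (rule *[OF assms(1)])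
  ultimately have "Dif (\<lambda>y. Dif f y u \<bullet> b) x v = Dif (\<lambda>y. Dif f y v \<bullet> b) x u"
    by simp
  then show "Dif (\<lambda>y. Dif f y u) x v \<bullet> b = Dif (\<lambda>y. Dif f y v) x u \<bullet> b"
    using *[OF smooth_on_Dif[OF assms(1)] assms(3)] by simp
qed

section \<open>Curvature\<close>

definition christoffel_on :: "(real^'n) set \<Rightarrow> 'n::finite christoffel \<Rightarrow> bool" where
  "christoffel_on S G \<longleftrightarrow> open S \<and> (\<forall>x\<in>S. bilinear (G x)) \<and>
     (\<forall>v w. smooth_on S (\<lambda>x. G x v w)) \<and> (\<forall>x\<in>S. \<forall>v w. G x v w = G x w v)"

lemma
  assumes "christoffel_on S G"
  shows christoffel_open: "open S"
    and christoffel_bilinear: "x \<in> S \<Longrightarrow> bilinear (G x)"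
    and christoffel_smooth: "smooth_on S (\<lambda>x. G x v w)"
    and christoffel_commute: "x \<in> S \<Longrightarrow> G x v w = G x w v"
    and christoffel_linear: "x \<in> S \<Longrightarrow> linear (G x v)"
    and christoffel_linear_left: "x \<in> S \<Longrightarrow> linear (\<lambda>v. G x v w)"
  using assms by (auto simp: christoffel_on_def bilinear_def)

lemma christoffel_has_derivative:
  "christoffel_on S G \<Longrightarrow> x \<in> S \<Longrightarrow> ((\<lambda>y. G y v w) has_derivative Dif (\<lambda>y. G y v w) x) (at x)"
  by (intro has_derivative_Dif smooth_on_differentiable_at[OF christoffel_smooth christoffel_open])

section \<open>Covariant derivatives along maps and their commutators\<close>

lemma christoffel_along_has_derivative:
  fixes h :: "'v::real_normed_vector \<Rightarrow> real^'n::finite"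
  assumes G: "christoffel_on S G" and "open U" "u \<in> U" "\<And>t. t \<in> U \<Longrightarrow> h t \<in> S"
    and h: "(h has_derivative h') (at u)"
    and V: "(V has_derivative V') (at u)" and W: "(W has_derivative W') (at u)"
  shows "((\<lambda>t. G (h t) (V t) (W t)) has_derivative
    (\<lambda>w. Dif (\<lambda>y. G y (V u) (W u)) (h u) (h' w) + G (h u) (V' w) (W u) + G (h u) (V u) (W' w))) (at u)"
proof (rule has_derivative_bilinear_field[OF assms(2,3), where B = "\<lambda>t. G (h t)"])
  show "bilinear (G (h t))" if "t \<in> U" for t
    by (rule christoffel_bilinear[OF G assms(4)[OF that]])
  show "((\<lambda>t. G (h t) v w) has_derivative (\<lambda>x. Dif (\<lambda>y. G y v w) (h u) (h' x))) (at u)" for v w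
    by (rule has_derivative_compose[OF h christoffel_has_derivative[OF G assms(4)[OF assms(3)]]])
qed (fact V W)+

lemma curvature_eq:
  shows "curvature G x u v w = Dif (\<lambda>y. G y v w) x u - Dif (\<lambda>y. G y u w) x v
    + G x u (G x v w) - G x v (G x u w)"
proof -
  have "covd G v (\<lambda>_. w) = (\<lambda>y. G y v w)" for v
    by (rule ext) (simp add: covd_def)
  then show ?thesis
    by (simp add: curvature_def) (simp add: covd_def)
qed

text \<open>The second derivatives of \<open>V\<close> and of \<open>h\<close> are symmetric and
  cancel, so the curvature at the image point remains. The map may be the identity, a change of
  coordinates, an automorphism in charts or a parametrized surface; each of these cases is
  used.\<close>

lemma covd_along_commutator:
  fixes h :: "'v::real_normed_vector \<Rightarrow> real^'n::finite"
  assumes G: "christoffel_on S G" and U: "open U" "u \<in> U" and hS: "\<And>t. t \<in> U \<Longrightarrow> h t \<in> S"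
    and h: "smooth_on U h" and V: "smooth_on U V"
  shows "covd_along G h w (covd_along G h e V) u - covd_along G h e (covd_along G h w V) u
    = curvature G (h u) (Dif h u w) (Dif h u e) (V u)"
proof -
  note diff = has_derivative_Dif[OF smooth_on_differentiable_at[OF _ U]]
  have D: "Dif (covd_along G h e V) u w = Dif (\<lambda>t. Dif V t e) u w
      + (Dif (\<lambda>y. G y (Dif h u e) (V u)) (h u) (Dif h u w)
        + G (h u) (Dif (\<lambda>t. Dif h t e) u w) (V u) + G (h u) (Dif h u e) (Dif V u w))" for e w
    unfolding covd_along_def
    by (intro Dif_eqI[THEN fun_cong] has_derivative_add diff smooth_on_Dif V
        christoffel_along_has_derivative[OF G U hS] h)
  have sym: "Dif (\<lambda>t. Dif V t e) u w = Dif (\<lambda>t. Dif V t w) u e"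
      "Dif (\<lambda>t. Dif h t e) u w = Dif (\<lambda>t. Dif h t w) u e"
    by (rule Dif_Dif_commute[OF _ U]; fact)+
  note lin = christoffel_linear[OF G hS[OF U(2)]]
  show ?thesis
    unfolding curvature_eq covd_along_def[of G h w "covd_along G h e V"]
      covd_along_def[of G h e "covd_along G h w V"] D
    by (simp add: sym covd_along_def linear_add[OF lin])
qed

lemma christoffel_field_has_derivative:
  assumes G: "christoffel_on S G" and x: "x \<in> S"
    and V: "(V has_derivative V') (at x)" and W: "(W has_derivative W') (at x)"
  shows "((\<lambda>y. G y (V y) (W y)) has_derivative
    (\<lambda>u. Dif (\<lambda>y. G y (V x) (W x)) x u + G x (V' u) (W x) + G x (V x) (W' u))) (at x)"
  by (rule has_derivative_bilinear_field[OF christoffel_open[OF G] x christoffel_bilinear[OF G]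
        christoffel_has_derivative[OF G x] V W])

lemma covd_eq_covd_along: "covd G v Y x = covd_along G (\<lambda>y. y) v Y x"
  by (simp add: covd_def covd_along_def)

text \<open>The Ricci identity, as the case of the identity map. The definition of
  \<open>curvature\<close> has a constant field; here \<open>V\<close> may vary, as is needed for
  \<open>E\<close> and for iterated covariant derivatives.\<close>

lemma covd_commutator:
  assumes G: "christoffel_on S G" and x: "x \<in> S" and V: "smooth_on S V"
  shows "covd G u (covd G v V) x - covd G v (covd G u V) x = curvature G x u v (V x)"
proof -
  have id: "smooth_on S (\<lambda>y. y)"
    unfolding smooth_on_def
  proof
    show "Ck_on k S (\<lambda>y. y)" for k
      by (cases k) (auto simp: Ck_on_const differentiable_on_def)
  qed
  have along: "covd_along G (\<lambda>y. y) v Y = covd G v Y" for v Y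
    by (rule ext) (simp add: covd_eq_covd_along)
  have "covd_along G (\<lambda>y. y) u (covd_along G (\<lambda>y. y) v V) x
      - covd_along G (\<lambda>y. y) v (covd_along G (\<lambda>y. y) u V) x
    = curvature G x (Dif (\<lambda>y. y) x u) (Dif (\<lambda>y. y) x v) (V x)"
    by (rule covd_along_commutator[OF G christoffel_open[OF G] x _ id V])
  then show ?thesis
    unfolding along by simp
qed

lemma smooth_on_covd:
  assumes G: "christoffel_on S G" and V: "smooth_on S V"
  shows "smooth_on S (covd G v V)"
proof -
  note op = christoffel_open[OF G]
  have "smooth_on S (\<lambda>x. G x v (V x))"
    by (rule smooth_on_linear_field[OF op christoffel_linear[OF G] christoffel_smooth[OF G] V])
  then have "smooth_on S (\<lambda>x. Dif V x v + G x v (V x))"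
    by (rule smooth_on_add[OF op smooth_on_Dif[OF V]])
  then show ?thesis
    by (simp add: covd_def[abs_def])
qed

lemma covd_diff:
  assumes G: "christoffel_on S G" and x: "x \<in> S" and V: "smooth_on S V" and W: "smooth_on S W"
  shows "covd G v (\<lambda>y. V y - W y) x = covd G v V x - covd G v W x"
proof -
  note diff = has_derivative_Dif[OF smooth_on_differentiable_at[OF _ christoffel_open[OF G] x]]
  have "Dif (\<lambda>y. V y - W y) x v = Dif V x v - Dif W x v"
    by (intro Dif_eqI[THEN fun_cong] has_derivative_diff diff V W)
  then show ?thesis
    by (simp add: covd_def linear_diff[OF christoffel_linear[OF G x]])
qed

lemma smooth_on_curvature:
  assumes G: "christoffel_on S G"
  shows "smooth_on S (\<lambda>x. curvature G x u v w)"
  unfolding curvature_def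
  by (rule smooth_on_diff[OF christoffel_open[OF G]]; rule smooth_on_covd[OF G smooth_on_covd[OF G smooth_on_const]])

lemma curvature_linear:
  assumes G: "christoffel_on S G" and x: "x \<in> S"
  shows "linear (\<lambda>u. curvature G x u v w)" "linear (\<lambda>v. curvature G x u v w)"
    "linear (\<lambda>w. curvature G x u v w)"
proof -
  have D: "linear (Dif (\<lambda>y. G y v w) x)" for v w
    using has_derivative_linear[OF christoffel_has_derivative[OF G x]] .
  note S = christoffel_open[OF G] x
  note d = smooth_on_differentiable_at[OF christoffel_smooth[OF G] S]
  have D1: "linear (\<lambda>a. Dif (\<lambda>y. G y a w) x u)" for u w
    by (rule linear_Dif_field[OF S christoffel_linear_left[OF G] d])
  have D2: "linear (\<lambda>a. Dif (\<lambda>y. G y w a) x u)" for u w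
    by (rule linear_Dif_field[OF S christoffel_linear[OF G] d])
  note simps = curvature_eq linear_add[OF D1] linear_scale[OF D1] linear_add[OF D2] linear_scale[OF D2] linear_add[OF D] linear_scale[OF D]
    linear_add[OF christoffel_linear[OF G x]] linear_scale[OF christoffel_linear[OF G x]]
    linear_add[OF christoffel_linear_left[OF G x]] linear_scale[OF christoffel_linear_left[OF G x]]
    algebra_simps
  show "linear (\<lambda>u. curvature G x u v w)" "linear (\<lambda>v. curvature G x u v w)"
    "linear (\<lambda>w. curvature G x u v w)"
    by (rule linearI; simp add: simps)+
qed

section \<open>Symmetries of the curvature, Bianchi identities and naturality\<close>

lemma curvature_skew: "curvature G x u v w = - curvature G x v u w"
  by (simp add: curvature_def)

lemma curvature_same: "curvature G x v v w = 0"
  by (simp add: curvature_def)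

text \<open>With symmetric Christoffel symbols, the derivative terms and the quadratic terms of the
  cyclic sum each cancel in pairs.\<close>

lemma first_bianchi:
  assumes G: "christoffel_on S G" and x: "x \<in> S"
  shows "curvature G x u v w + curvature G x v w u + curvature G x w u v = 0"
proof -
  have "Dif (\<lambda>y. G y v w) x u = Dif (\<lambda>y. G y w v) x u" for u v w
    by (rule fun_cong[OF Dif_cong[OF christoffel_open[OF G] x]]) (rule christoffel_commute[OF G])
  then show ?thesis
    using christoffel_commute[OF G x] by (simp add: curvature_eq)
qed

text \<open>The Jacobi identity for the commutators of \<open>\<nabla>\<^sub>u\<close>, \<open>\<nabla>\<^sub>v\<close>, \<open>\<nabla>\<^sub>w\<close>.\<close>

lemma second_bianchi:
  fixes u v w z :: "real^'n::finite"
  assumes G: "christoffel_on S G" and x: "x \<in> S"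
  defines "B \<equiv> \<lambda>u v w. covd G u (\<lambda>y. curvature G y v w z) x - curvature G x v w (G x u z)"
  shows "B u v w + B v w u + B w u v = 0"
proof -
  have sm: "smooth_on S (covd G v V)" if "smooth_on S V" for v V
    by (rule smooth_on_covd[OF G that])
  define Z where "Z = (\<lambda>y::real^'n. z)"
  have Z: "smooth_on S Z" unfolding Z_def by (rule smooth_on_const)
  have "B u v w = (covd G u (covd G v (covd G w Z)) x - covd G u (covd G w (covd G v Z)) x)
      - (covd G v (covd G w (covd G u Z)) x - covd G w (covd G v (covd G u Z)) x)" for u v w
  proof -
    have "covd G u (\<lambda>y. curvature G y v w z) x
        = covd G u (covd G v (covd G w Z)) x - covd G u (covd G w (covd G v Z)) x"
      unfolding curvature_def Z_def[symmetric] by (rule covd_diff[OF G x]) (intro sm Z)+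
    moreover have "curvature G x v w (G x u z)
        = covd G v (covd G w (covd G u Z)) x - covd G w (covd G v (covd G u Z)) x"
      using covd_commutator[OF G x sm[OF Z], of v w u] by (simp add: covd_def[of G u Z x]) (simp add: Z_def)
    ultimately show ?thesis by (simp add: B_def)
  qed
  from this[of u v w] this[of v w u] this[of w u v] show ?thesis by simp
qed

text \<open>By \<open>affine_at\<close>, \<open>Dh (\<nabla>\<^sub>v w)\<close> is the covariant derivative of \<open>Dh w\<close> along \<open>h\<close>, so
  \<open>covd_along_commutator\<close> applies.\<close>

lemma curvature_affine:
  fixes h :: "real^'n::finite \<Rightarrow> real^'n"
  assumes G: "christoffel_on S G" and G': "christoffel_on S' G'"
    and U: "open U" "U \<subseteq> S" "x \<in> U" and h: "smooth_on U h" and hS: "\<And>y. y \<in> U \<Longrightarrow> h y \<in> S'"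
    and aff: "\<And>y. y \<in> U \<Longrightarrow> affine_at G G' h y"
  shows "Dif h x (curvature G x u v w) = curvature G' (h x) (Dif h x u) (Dif h x v) (Dif h x w)"
proof -
  have xS: "x \<in> S" using U by blast
  have lin: "linear (Dif h y)" if "y \<in> U" for y
    using linear_Dif[OF h U(1) that] .
  have along: "covd_along G' h v (\<lambda>y. Dif h y w) y = Dif h y (G y v w)" if "y \<in> U" for y v w
    using aff[OF that] by (simp add: affine_at_def covd_along_def)
  have iter: "covd_along G' h u (covd_along G' h v (\<lambda>y. Dif h y w)) x
      = Dif h x (G x u (G x v w)) + Dif h x (Dif (\<lambda>y. G y v w) x u)" for u v w
  proof -
    have "Dif (covd_along G' h v (\<lambda>y. Dif h y w)) x u = Dif (\<lambda>y. Dif h y (G y v w)) x u"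
      by (rule fun_cong[OF Dif_cong[OF U(1,3)]]) (rule along)
    also have "\<dots> = Dif (\<lambda>y. Dif h y (G x v w)) x u + Dif h x (Dif (\<lambda>y. G y v w) x u)"
      by (intro Dif_eqI[THEN fun_cong] has_derivative_linear_field[OF U(1,3) lin] has_derivative_Dif
          smooth_on_differentiable_at[OF smooth_on_Dif[OF h] U(1,3)]
          smooth_on_differentiable_at[OF christoffel_smooth[OF G] christoffel_open[OF G] xS])
    finally show ?thesis
      using along[OF U(3), of u "G x v w"] along[OF U(3), of v w] by (simp add: covd_along_def)
  qed
  have "curvature G' (h x) (Dif h x u) (Dif h x v) (Dif h x w)
      = covd_along G' h u (covd_along G' h v (\<lambda>y. Dif h y w)) x
        - covd_along G' h v (covd_along G' h u (\<lambda>y. Dif h y w)) x"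
    by (rule covd_along_commutator[OF G' U(1,3) hS h smooth_on_Dif[OF h], symmetric])
  also have "\<dots> = Dif h x (curvature G x u v w)"
    unfolding iter curvature_eq linear_add[OF lin[OF U(3)]] linear_diff[OF lin[OF U(3)]] by simp
  finally show ?thesis by simp
qed

section \<open>Curvature along totally geodesic surfaces\<close>

lemma inner_cramer:
  fixes p q :: "'a::real_inner"
  assumes N: "N = a *\<^sub>R p + b *\<^sub>R q" and ne: "(p \<bullet> p) * (q \<bullet> q) - (p \<bullet> q) * (p \<bullet> q) \<noteq> 0"
  shows "a = ((N \<bullet> p) * (q \<bullet> q) - (N \<bullet> q) * (p \<bullet> q)) / ((p \<bullet> p) * (q \<bullet> q) - (p \<bullet> q) * (p \<bullet> q))"
proof -
  have "(N \<bullet> p) * (q \<bullet> q) - (N \<bullet> q) * (p \<bullet> q) = a * ((p \<bullet> p) * (q \<bullet> q) - (p \<bullet> q) * (p \<bullet> q))"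
    unfolding N by (simp add: inner_add_left inner_commute[of q p] algebra_simps)
  then show ?thesis using ne by simp
qed

lemma gram_nonzero:
  fixes p q :: "'a::real_inner"
  assumes "\<And>a b. a *\<^sub>R p + b *\<^sub>R q = 0 \<Longrightarrow> a = 0 \<and> b = 0"
  shows "(p \<bullet> p) * (q \<bullet> q) - (p \<bullet> q) * (p \<bullet> q) \<noteq> 0"
proof
  assume z: "(p \<bullet> p) * (q \<bullet> q) - (p \<bullet> q) * (p \<bullet> q) = 0"
  \<comment> \<open>This is \<open>p \<bullet> p\<close> times the part of \<open>q\<close>
    orthogonal to \<open>p\<close>, so its square is \<open>p \<bullet> p\<close> times the Gram
    determinant. If the determinant vanishes, \<open>r = 0\<close> is a linear relation.\<close>
  define r where "r = (p \<bullet> p) *\<^sub>R q + (- (p \<bullet> q)) *\<^sub>R p"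
  have "r \<bullet> r = (p \<bullet> p) * ((p \<bullet> p) * (q \<bullet> q) - (p \<bullet> q) * (p \<bullet> q))"
    unfolding r_def by (simp add: inner_add_left inner_add_right inner_diff_left inner_diff_right inner_commute[of q p] algebra_simps)
  then have "r = 0" using z by simp
  then have "p = 0" using assms[of "- (p \<bullet> q)" "p \<bullet> p"] by (simp add: r_def add.commute)
  then show False using assms[of 1 0] by simp
qed

text \<open>The components are given by Cramer's rule.\<close>

lemma tangent_field_components:
  fixes h :: "real^2 \<Rightarrow> real^'n::finite"
  assumes U: "open U" "u \<in> U" and h: "smooth_on U h"
    and inj: "\<And>t. t \<in> U \<Longrightarrow> inj (Dif h t)"
    and N: "N differentiable at u" and tan: "\<And>t. t \<in> U \<Longrightarrow> N t \<in> range (Dif h t)"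
  shows "\<exists>Y. Y differentiable at u \<and> (\<forall>t\<in>U. N t = Dif h t (Y t))"
proof -
  define e1 e2 :: "real^2" where "e1 = axis 1 1" and "e2 = axis 2 1"
  have e: "a *\<^sub>R e1 + b *\<^sub>R e2 = 0 \<Longrightarrow> a = 0 \<and> b = 0" for a b
    by (auto simp: e1_def e2_def vec_eq_iff axis_def forall_2)
  have ex: "x = (x $ 1) *\<^sub>R e1 + (x $ 2) *\<^sub>R e2" for x
    by (simp add: e1_def e2_def vec_eq_iff axis_def forall_2)
  define p q where "p t = Dif h t e1" and "q t = Dif h t e2" for t
  define \<Delta> where "\<Delta> t = (p t \<bullet> p t) * (q t \<bullet> q t) - (p t \<bullet> q t) * (p t \<bullet> q t)" for t
  have lin: "linear (Dif h t)" if "t \<in> U" for t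
    using linear_Dif[OF h U(1) that] .
  have ne: "\<Delta> t \<noteq> 0" if "t \<in> U" for t
    unfolding \<Delta>_def
  proof (rule gram_nonzero)
    fix a b assume "a *\<^sub>R p t + b *\<^sub>R q t = 0"
    then have "Dif h t (a *\<^sub>R e1 + b *\<^sub>R e2) = 0"
      by (simp add: p_def q_def linear_add[OF lin[OF that]] linear_scale[OF lin[OF that]])
    then have "a *\<^sub>R e1 + b *\<^sub>R e2 = 0"
      using linear_injective_0[OF lin[OF that]] inj[OF that] by blast
    then show "a = 0 \<and> b = 0" by (rule e)
  qed
  define Y where "Y t = (((N t \<bullet> p t) * (q t \<bullet> q t) - (N t \<bullet> q t) * (p t \<bullet> q t)) / \<Delta> t) *\<^sub>R e1
    + (((N t \<bullet> q t) * (p t \<bullet> p t) - (N t \<bullet> p t) * (p t \<bullet> q t)) / \<Delta> t) *\<^sub>R e2" for t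
  have "p differentiable at u" "q differentiable at u"
    unfolding p_def[abs_def] q_def[abs_def]
    by (rule smooth_on_differentiable_at[OF smooth_on_Dif[OF h] U])+
  then have "Y differentiable at u"
    using N ne[OF U(2)] unfolding Y_def[abs_def] \<Delta>_def by (auto intro!: derivative_intros)
  moreover have "N t = Dif h t (Y t)" if t: "t \<in> U" for t
  proof -
    obtain x where "N t = Dif h t x" using tan[OF t] by blast
    then have "N t = Dif h t ((x $ 1) *\<^sub>R e1 + (x $ 2) *\<^sub>R e2)"
      using ex[of x] by simp
    also have "\<dots> = (x $ 1) *\<^sub>R p t + (x $ 2) *\<^sub>R q t"
      by (simp add: p_def q_def linear_add[OF lin[OF t]] linear_scale[OF lin[OF t]])
    finally have Nt: "N t = (x $ 1) *\<^sub>R p t + (x $ 2) *\<^sub>R q t" .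
    then have Nt': "N t = (x $ 2) *\<^sub>R q t + (x $ 1) *\<^sub>R p t" by simp
    have "x $ 1 = ((N t \<bullet> p t) * (q t \<bullet> q t) - (N t \<bullet> q t) * (p t \<bullet> q t)) / \<Delta> t"
      using inner_cramer[OF Nt] ne[OF t] by (simp add: \<Delta>_def)
    moreover have "x $ 2 = ((N t \<bullet> q t) * (p t \<bullet> p t) - (N t \<bullet> p t) * (p t \<bullet> q t)) / \<Delta> t"
      using inner_cramer[OF Nt'] ne[OF t] by (simp add: \<Delta>_def inner_commute mult.commute)
    ultimately have "Y t = x" using ex[of x] by (simp add: Y_def)
    then show ?thesis using \<open>N t = Dif h t x\<close> by simp
  qed
  ultimately show ?thesis by auto
qed

text \<open>The curvature is a commutator of covariant derivatives along the surface, so it suffices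
  that these preserve tangency. The hypothesis \<open>tot\<close> concerns constant parameter
  fields, whereas after one derivative the components \<open>Y\<close> vary. As \<open>Y\<close> is
  differentiable, the Leibniz rule leaves a constant-field term and a term
  \<open>Dif h u (Dif Y u w)\<close>, both tangent.\<close>

lemma curvature_tangent:
  fixes h :: "real^2 \<Rightarrow> real^'n::finite"
  assumes G: "christoffel_on S G" and U: "open U" "u \<in> U" and hS: "\<And>t. t \<in> U \<Longrightarrow> h t \<in> S"
    and h: "smooth_on U h" and inj: "\<And>t. t \<in> U \<Longrightarrow> inj (Dif h t)"
    and tot: "\<And>t w y. t \<in> U \<Longrightarrow> covd_along G h w (\<lambda>t. Dif h t y) t \<in> range (Dif h t)"
  shows "curvature G (h u) (Dif h u w) (Dif h u e) (Dif h u z) \<in> range (Dif h u)"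
proof -
  have lin: "linear (Dif h t)" if "t \<in> U" for t
    using linear_Dif[OF h U(1) that] .
  have sub: "subspace (range (Dif h u))"
    using linear_subspace_image[OF lin[OF U(2)] subspace_UNIV] .
  have iter: "covd_along G h w (covd_along G h e (\<lambda>t. Dif h t z)) u \<in> range (Dif h u)" for w e
  proof -
    let ?N = "covd_along G h e (\<lambda>t. Dif h t z)"
    note diff = smooth_on_differentiable_at[OF _ U]
    have "?N differentiable at u"
      unfolding covd_along_def[abs_def]
    proof (rule differentiable_add)
      show "(\<lambda>t. Dif (\<lambda>t. Dif h t z) t e) differentiable at u"
        by (intro diff smooth_on_Dif h)
      show "(\<lambda>t. G (h t) (Dif h t e) (Dif h t z)) differentiable at u"
        by (rule differentiableI, rule christoffel_along_has_derivative[OF G U hS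
            has_derivative_Dif[OF diff[OF h]] has_derivative_Dif[OF diff[OF smooth_on_Dif[OF h]]]
            has_derivative_Dif[OF diff[OF smooth_on_Dif[OF h]]]])
    qed
    from tangent_field_components[OF U h inj this tot]
    obtain Y where Y: "Y differentiable at u" "\<And>t. t \<in> U \<Longrightarrow> ?N t = Dif h t (Y t)"
      by auto
    have "Dif ?N u w = Dif (\<lambda>t. Dif h t (Y t)) u w"
      using Y(2) by (rule fun_cong[OF Dif_cong[OF U]])
    also have "\<dots> = Dif (\<lambda>t. Dif h t (Y u)) u w + Dif h u (Dif Y u w)"
      by (intro Dif_eqI[THEN fun_cong] has_derivative_linear_field[OF U lin] has_derivative_Dif
          diff smooth_on_Dif h Y)
    finally have "covd_along G h w ?N u = covd_along G h w (\<lambda>t. Dif h t (Y u)) u + Dif h u (Dif Y u w)"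
      using Y(2)[OF U(2)] by (simp add: covd_along_def[of G h w])
    then show ?thesis
      using subspace_add[OF sub tot[OF U(2), of w "Y u"], of "Dif h u (Dif Y u w)"] by simp
  qed
  show ?thesis
    using subspace_diff[OF sub iter[of w e] iter[of e w]]
    by (simp add: covd_along_commutator[OF G U hS h smooth_on_Dif[OF h]])
qed

section \<open>Traces\<close>

lemma trace_matrix: "trace (matrix f) = (\<Sum>i\<in>UNIV. f (axis i 1) $ i)"
  for f :: "real^'n::finite \<Rightarrow> real^'n"
  by (simp add: trace_def matrix_def)

lemma trace_matrix_add:
  "trace (matrix (\<lambda>v. f v + g v)) = trace (matrix f) + trace (matrix g)"
  for f g :: "real^'n::finite \<Rightarrow> real^'n"
  by (simp add: trace_matrix sum.distrib)

lemma trace_matrix_diff: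
  "trace (matrix (\<lambda>v. f v - g v)) = trace (matrix f) - trace (matrix g)"
  for f g :: "real^'n::finite \<Rightarrow> real^'n"
  by (simp add: trace_matrix sum_subtractf)

lemma trace_matrix_scale: "trace (matrix (\<lambda>v. c *\<^sub>R f v)) = c * trace (matrix f)"
  for f :: "real^'n::finite \<Rightarrow> real^'n"
  by (simp add: trace_matrix sum_distrib_left)

lemma trace_matrix_minus: "trace (matrix (\<lambda>v. - f v)) = - trace (matrix f)"
  for f :: "real^'n::finite \<Rightarrow> real^'n"
  by (simp add: trace_matrix sum_negf)

lemma trace_matrix_id: "trace (matrix (\<lambda>v::real^'n::finite. v)) = real CARD('n)"
  by (simp add: trace_matrix)

lemma trace_matrix_rank_one:
  fixes e :: "real^'n::finite"
  assumes "linear \<phi>"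
  shows "trace (matrix (\<lambda>v. \<phi> v *\<^sub>R e)) = \<phi> e"
proof -
  have "\<phi> e = \<phi> (\<Sum>i\<in>UNIV. (e $ i) *\<^sub>R axis i 1)"
    using basis_expansion[of e] by (simp add: scalar_mult_eq_scaleR)
  also have "\<dots> = (\<Sum>i\<in>UNIV. e $ i * \<phi> (axis i 1))"
    by (simp add: linear_sum[OF assms] linear_scale[OF assms])
  finally show ?thesis
    by (simp add: trace_matrix mult.commute)
qed

lemma trace_matrix_commute:
  fixes f g :: "real^'n::finite \<Rightarrow> real^'n"
  assumes "linear f" "linear g"
  shows "trace (matrix (\<lambda>v. f (g v))) = trace (matrix (\<lambda>v. g (f v)))"
  using trace_mul_sym[of "matrix f" "matrix g"] matrix_compose[OF assms] matrix_compose[OF assms(2,1)]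
  by (simp add: o_def)

section \<open>Radiant structures in a chart\<close>

locale radiant_chart =
  fixes S :: "(real^'n::finite) set" and G :: "'n christoffel" and E :: "real^'n \<Rightarrow> real^'n"
  assumes G: "christoffel_on S G" and E_smooth: "smooth_on S E"
    and radiant: "\<And>x v. x \<in> S \<Longrightarrow> covd G v E x = v"
begin

lemmas S_open = christoffel_open[OF G]
lemmas G_commute = christoffel_commute[OF G]

lemma E_has_derivative: "x \<in> S \<Longrightarrow> (E has_derivative Dif E x) (at x)"
  by (intro has_derivative_Dif smooth_on_differentiable_at[OF E_smooth S_open])

lemma Dif_E: "x \<in> S \<Longrightarrow> Dif E x v = v - G x v (E x)"
  using radiant[of x v] by (simp add: covd_def eq_diff_eq)

text \<open>The covariant derivative of \<open>E\<close> along a constant field \<open>v\<close> is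
  \<open>v\<close> itself; differentiating it along \<open>u\<close> gives \<open>G x u v\<close>,
  which is symmetric.\<close>

lemma curvature_E:
  assumes x: "x \<in> S"
  shows "curvature G x u v (E x) = 0"
proof -
  have "covd G u (covd G v E) x = G x u v" for u v
  proof -
    have "Dif (covd G v E) x = Dif (\<lambda>_. v) x"
      by (rule Dif_cong[OF S_open x]) (rule radiant)
    then show ?thesis
      by (simp add: covd_def[of G u] radiant[OF x])
  qed
  then show ?thesis
    using covd_commutator[OF G x E_smooth, of u v] G_commute[OF x, of u v] by simp
qed

text \<open>First Bianchi identity with \<open>E\<close> in one slot: the cyclic term in which the
  curvature acts on \<open>E\<close> vanishes.\<close>

lemma curvature_E_commute:
  assumes x: "x \<in> S"
  shows "curvature G x (E x) v w = curvature G x (E x) w v"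
  using first_bianchi[OF G x, of "E x" v w] curvature_E[OF x, of v w] curvature_skew[of G x w "E x" v]
  by simp

text \<open>In general the Lie derivative of a torsion-free connection is the second covariant
  derivative of the field plus the curvature contracted with it. The former vanishes for
  \<open>E\<close>. In coordinates, \<open>Dif_E\<close> eliminates the derivatives of
  \<open>E\<close>.\<close>

lemma lie_derivative_conn_eq_curvature:
  assumes x: "x \<in> S"
  shows "lie_derivative_conn G E x v w = curvature G x (E x) v w"
proof -
  have const: "covd G v (\<lambda>_. w) = (\<lambda>y. G y v w)" "bracket E (\<lambda>_. v) = (\<lambda>y. - Dif E y v)" for v w
    by (rule ext; simp add: covd_def bracket_def)+
  have "Dif (\<lambda>y. - Dif E y w) x v = Dif (\<lambda>y. G y w (E y) - w) x v"
    by (rule fun_cong[OF Dif_cong[OF S_open x]]) (simp add: Dif_E)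
  also have "\<dots> = Dif (\<lambda>y. G y w (E x)) x v + G x 0 (E x) + G x w (Dif E x v) - 0"
    by (rule fun_cong[OF Dif_eqI], rule has_derivative_diff[OF christoffel_field_has_derivative[OF G x
        has_derivative_const E_has_derivative[OF x]] has_derivative_const])
  finally have D: "Dif (\<lambda>y. - Dif E y w) x v = Dif (\<lambda>y. G y w (E x)) x v + G x w (Dif E x v)"
    by (simp add: linear_0[OF christoffel_linear_left[OF G x]])
  have sym: "Dif (\<lambda>y. G y w (E x)) x v = Dif (\<lambda>y. G y (E x) w) x v"
    by (rule fun_cong[OF Dif_cong[OF S_open x]]) (rule G_commute)
  note lin = linear_diff[OF christoffel_linear[OF G x]]
  show ?thesis
    unfolding lie_derivative_conn_def const curvature_eq
    by (simp add: bracket_def covd_def[of G v] covd_def[of G "- _"] D sym Dif_E[OF x] lin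
        linear_neg[OF christoffel_linear[OF G x]] linear_neg[OF christoffel_linear_left[OF G x]]
        linear_diff[OF christoffel_linear_left[OF G x]]
        G_commute[OF x, of "G x v w" "E x"] G_commute[OF x, of "G x v (E x)" w]
        G_commute[OF x, of w v] G_commute[OF x, of w "E x"])
qed

text \<open>In view of \<open>\<nabla>\<^sub>v E = v\<close>, \<open>lieE P\<close> is the Lie derivative of \<open>P\<close> along \<open>E\<close>.\<close>

definition horizontal :: "(real^'n \<Rightarrow> real^'n \<Rightarrow> real^'n \<Rightarrow> real) \<Rightarrow> bool" where
  "horizontal P \<longleftrightarrow> (\<forall>x\<in>S. bilinear (P x)) \<and> (\<forall>v w. smooth_on S (\<lambda>x. P x v w)) \<and>
     (\<forall>x\<in>S. \<forall>v w. P x v w = P x w v) \<and> (\<forall>x\<in>S. \<forall>w. P x (E x) w = 0)"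

definition lieE :: "(real^'n \<Rightarrow> real^'n \<Rightarrow> real^'n \<Rightarrow> real) \<Rightarrow> real^'n \<Rightarrow> real^'n \<Rightarrow> real^'n \<Rightarrow> real" where
  "lieE P x v w = Dif (\<lambda>y. P y v w) x (E x) - P x v (G x (E x) w) - P x (G x v (E x)) w + 2 * P x v w"

lemma
  assumes "horizontal P"
  shows horizontal_smooth: "smooth_on S (\<lambda>x. P x v w)"
    and horizontal_commute: "x \<in> S \<Longrightarrow> P x v w = P x w v"
    and horizontal_E: "x \<in> S \<Longrightarrow> P x (E x) w = 0"
    and horizontal_linear: "x \<in> S \<Longrightarrow> linear (P x v)"
    and horizontal_linear_left: "x \<in> S \<Longrightarrow> linear (\<lambda>v. P x v w)"
  using assms by (auto simp: horizontal_def bilinear_def)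

lemma horizontal_E_right: "horizontal P \<Longrightarrow> x \<in> S \<Longrightarrow> P x w (E x) = 0"
  using horizontal_commute[of P x w "E x"] horizontal_E[of P x w] by simp

lemma horizontal_differentiable: "horizontal P \<Longrightarrow> x \<in> S \<Longrightarrow> (\<lambda>y. P y v w) differentiable at x"
  by (rule smooth_on_differentiable_at[OF horizontal_smooth S_open])

lemmas horizontal_has_derivative = has_derivative_Dif[OF horizontal_differentiable]

lemma horizontal_Dif_linear:
  assumes P: "horizontal P" and x: "x \<in> S"
  shows "linear (\<lambda>v. Dif (\<lambda>y. P y v w) x u)" "linear (Dif (\<lambda>y. P y v w) x)"
proof -
  show "linear (\<lambda>v. Dif (\<lambda>y. P y v w) x u)"
    by (rule linear_Dif_field[OF S_open x horizontal_linear_left[OF P] horizontal_differentiable[OF P x]])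
  show "linear (Dif (\<lambda>y. P y v w) x)"
    by (rule has_derivative_linear[OF horizontal_has_derivative[OF P x]])
qed

text \<open>Here \<open>E\<close> is frozen at \<open>x\<close> before differentiating.\<close>

lemma horizontal_Dif_E:
  assumes P: "horizontal P" and x: "x \<in> S"
  shows "Dif (\<lambda>y. P y (E x) w) x v = - P x v w + P x (G x v (E x)) w"
proof -
  have "Dif (\<lambda>y. P y (E y) w) x v = Dif (\<lambda>_. 0) x v"
    by (rule fun_cong[OF Dif_cong[OF S_open x]]) (rule horizontal_E[OF P])
  moreover have "Dif (\<lambda>y. P y (E y) w) x v = Dif (\<lambda>y. P y (E x) w) x v + P x (Dif E x v) w"
    by (rule fun_cong[OF Dif_eqI], rule has_derivative_linear_field[OF S_open x horizontal_linear_left[OF P]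
        horizontal_has_derivative[OF P x] E_has_derivative[OF x]])
  ultimately show ?thesis
    by (simp add: Dif_E[OF x] linear_diff[OF horizontal_linear_left[OF P x]])
qed

subsection \<open>Modification along the radiant field\<close>

definition modify :: "(real^'n \<Rightarrow> real^'n \<Rightarrow> real^'n \<Rightarrow> real) \<Rightarrow> 'n christoffel" where
  "modify P x v w = G x v w + P x v w *\<^sub>R E x"

lemma christoffel_modify:
  assumes P: "horizontal P"
  shows "christoffel_on S (modify P)"
  unfolding christoffel_on_def
proof (intro conjI ballI allI)
  show "open S" by (rule S_open)
  show "bilinear (modify P x)" if x: "x \<in> S" for x
    unfolding bilinear_def modify_def
    by (intro conjI allI linearI)
      (simp_all add: linear_add[OF christoffel_linear[OF G x]] linear_scale[OF christoffel_linear[OF G x]]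
        linear_add[OF christoffel_linear_left[OF G x]] linear_scale[OF christoffel_linear_left[OF G x]]
        linear_add[OF horizontal_linear[OF P x]] linear_scale[OF horizontal_linear[OF P x]]
        linear_add[OF horizontal_linear_left[OF P x]] linear_scale[OF horizontal_linear_left[OF P x]]
        algebra_simps)
  show "smooth_on S (\<lambda>x. modify P x v w)" for v w
    unfolding modify_def
    by (rule smooth_on_add[OF S_open christoffel_smooth[OF G]
          smooth_on_scaleR[OF S_open horizontal_smooth[OF P] E_smooth]])
  show "modify P x v w = modify P x w v" if "x \<in> S" for x v w
    using G_commute[OF that, of v w] horizontal_commute[OF P that, of v w] by (simp add: modify_def)
qed

lemma radiant_chart_modify:
  assumes P: "horizontal P"
  shows "radiant_chart S (modify P) E"
proof
  show "covd (modify P) v E x = v" if "x \<in> S" for x v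
    using radiant[OF that, of v] by (simp add: covd_def modify_def horizontal_E_right[OF P that])
qed (rule christoffel_modify[OF P] E_smooth)+

text \<open>The terms along \<open>u\<close> and \<open>v\<close> come from differentiating the
  factor \<open>E\<close>, whose covariant derivative is the identity. Terms quadratic in
  \<open>P\<close> vanish because \<open>P\<close> annihilates \<open>E\<close>.\<close>

lemma curvature_modify:
  assumes P: "horizontal P" and x: "x \<in> S"
  shows "curvature (modify P) x u v w = curvature G x u v w
    + (Dif (\<lambda>y. P y v w) x u - Dif (\<lambda>y. P y u w) x v + P x u (G x v w) - P x v (G x u w)) *\<^sub>R E x
    + P x v w *\<^sub>R u - P x u w *\<^sub>R v"
proof -
  have D: "Dif (\<lambda>y. modify P y v w) x u = Dif (\<lambda>y. G y v w) x u
      + (P x v w *\<^sub>R (u - G x u (E x)) + Dif (\<lambda>y. P y v w) x u *\<^sub>R E x)" for u v w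
    unfolding modify_def Dif_E[OF x, symmetric]
    by (intro fun_cong[OF Dif_eqI] has_derivative_add has_derivative_scaleR
        christoffel_has_derivative[OF G x] horizontal_has_derivative[OF P x] E_has_derivative[OF x])
  have GG: "modify P x u (modify P x v w) = G x u (G x v w) + P x v w *\<^sub>R G x u (E x)
      + P x u (G x v w) *\<^sub>R E x" for u v w
    by (simp add: modify_def linear_add[OF christoffel_linear[OF G x]] linear_scale[OF christoffel_linear[OF G x]]
        linear_add[OF horizontal_linear[OF P x]] linear_scale[OF horizontal_linear[OF P x]]
        horizontal_E_right[OF P x])
  show ?thesis
    unfolding curvature_eq D GG by (simp add: algebra_simps)
qed

lemma lie_derivative_conn_modify:
  assumes P: "horizontal P" and x: "x \<in> S"
  shows "lie_derivative_conn (modify P) E x v w = curvature G x (E x) v w + lieE P x v w *\<^sub>R E x"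
  unfolding radiant_chart.lie_derivative_conn_eq_curvature[OF radiant_chart_modify[OF P] x]
    curvature_modify[OF P x] horizontal_Dif_E[OF P x] horizontal_E[OF P x] lieE_def
  by (simp add: add.assoc flip: scaleR_left_distrib)

lemma ricci_modify:
  assumes P: "horizontal P" and x: "x \<in> S"
  shows "ricci (modify P) x v w = ricci G x v w + lieE P x v w + (real CARD('n) - 2) * P x v w"
proof -
  define \<alpha> where "\<alpha> u = Dif (\<lambda>y. P y v w) x u - Dif (\<lambda>y. P y u w) x v
    + P x u (G x v w) - P x v (G x u w)" for u
  have lin: "linear \<alpha>"
    unfolding \<alpha>_def
    by (rule linearI; simp add: linear_add[OF horizontal_Dif_linear(1)[OF P x]]
        linear_scale[OF horizontal_Dif_linear(1)[OF P x]] linear_add[OF horizontal_Dif_linear(2)[OF P x]]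
        linear_scale[OF horizontal_Dif_linear(2)[OF P x]] linear_add[OF horizontal_linear[OF P x]]
        linear_scale[OF horizontal_linear[OF P x]] linear_add[OF horizontal_linear_left[OF P x]]
        linear_scale[OF horizontal_linear_left[OF P x]] linear_add[OF christoffel_linear_left[OF G x]]
        linear_scale[OF christoffel_linear_left[OF G x]] algebra_simps)
  have "ricci (modify P) x v w = trace (matrix (\<lambda>u. curvature G x u v w + \<alpha> u *\<^sub>R E x + P x v w *\<^sub>R u
      - P x u w *\<^sub>R v))"
    unfolding ricci_def curvature_modify[OF P x] \<alpha>_def ..
  \<comment> \<open>Origin of \<open>n - 2\<close>: the identity map has trace \<open>n\<close>, the
    rank-one map \<open>P x u w *\<^sub>R v\<close> takes off 1, and \<open>\<alpha> (E x)\<close>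
    takes off another 1.\<close>
  also have "\<dots> = ricci G x v w + \<alpha> (E x) + P x v w * real CARD('n) - P x v w"
    by (simp only: trace_matrix_add trace_matrix_diff trace_matrix_rank_one[OF lin] trace_matrix_scale
        trace_matrix_id trace_matrix_rank_one[OF horizontal_linear_left[OF P x]] ricci_def)
  also have "\<alpha> (E x) = lieE P x v w - P x v w"
    unfolding \<alpha>_def lieE_def horizontal_Dif_E[OF P x] horizontal_E[OF P x] by simp
  finally show ?thesis by (simp add: algebra_simps)
qed

lemma horizontal_combine:
  assumes P: "horizontal P" and Q: "horizontal Q"
  shows "horizontal (\<lambda>x v w. c * (P x v w - Q x v w))"
  unfolding horizontal_def
proof (intro conjI ballI allI)
  show "bilinear (\<lambda>v w. c * (P x v w - Q x v w))" if x: "x \<in> S" for x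
    unfolding bilinear_def
    by (intro conjI allI linearI)
      (simp_all add: linear_add[OF horizontal_linear[OF P x]] linear_scale[OF horizontal_linear[OF P x]]
        linear_add[OF horizontal_linear_left[OF P x]] linear_scale[OF horizontal_linear_left[OF P x]]
        linear_add[OF horizontal_linear[OF Q x]] linear_scale[OF horizontal_linear[OF Q x]]
        linear_add[OF horizontal_linear_left[OF Q x]] linear_scale[OF horizontal_linear_left[OF Q x]]
        algebra_simps)
  show "smooth_on S (\<lambda>x. c * (P x v w - Q x v w))" for v w
    by (rule smooth_on_mult[OF S_open smooth_on_const smooth_on_diff[OF S_open horizontal_smooth[OF P]
          horizontal_smooth[OF Q]]])
  show "c * (P x v w - Q x v w) = c * (P x w v - Q x w v)" if "x \<in> S" for x v w
    using horizontal_commute[OF P that, of v w] horizontal_commute[OF Q that, of v w] by simp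
  show "c * (P x (E x) w - Q x (E x) w) = 0" if "x \<in> S" for x w
    using horizontal_E[OF P that, of w] horizontal_E[OF Q that, of w] by simp
qed

lemma lieE_combine:
  assumes P: "horizontal P" and Q: "horizontal Q" and x: "x \<in> S"
  shows "lieE (\<lambda>x v w. c * (P x v w - Q x v w)) x v w = c * (lieE P x v w - lieE Q x v w)"
proof -
  have "Dif (\<lambda>y. c * (P y v w - Q y v w)) x = (\<lambda>u. c * (Dif (\<lambda>y. P y v w) x u - Dif (\<lambda>y. Q y v w) x u))"
    by (intro Dif_eqI has_derivative_mult_right has_derivative_diff horizontal_has_derivative[OF P x]
        horizontal_has_derivative[OF Q x])
  then show ?thesis
    by (simp add: lieE_def algebra_simps)
qed

lemma lieE_commute:
  assumes P: "horizontal P" and x: "x \<in> S"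
  shows "lieE P x v w = lieE P x w v"
proof -
  have "Dif (\<lambda>y. P y v w) x = Dif (\<lambda>y. P y w v) x"
    by (rule Dif_cong[OF S_open x]) (rule horizontal_commute[OF P])
  then show ?thesis
    using horizontal_commute[OF P x] by (simp add: lieE_def G_commute[OF x, of _ "E x"])
qed

section \<open>The Ricci tensor of a radiant structure\<close>

definition ricci_sym :: "real^'n \<Rightarrow> real^'n \<Rightarrow> real^'n \<Rightarrow> real" where
  "ricci_sym x v w = (ricci G x v w + ricci G x w v) / 2"

lemma ricci_linear:
  assumes x: "x \<in> S"
  shows "linear (\<lambda>v. ricci G x v w)" "linear (ricci G x v)"
  unfolding ricci_def
  by (rule linearI; simp add: linear_add[OF curvature_linear(2)[OF G x]] linear_scale[OF curvature_linear(2)[OF G x]]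
      linear_add[OF curvature_linear(3)[OF G x]] linear_scale[OF curvature_linear(3)[OF G x]]
      trace_matrix_add trace_matrix_scale)+

lemma smooth_on_ricci: "smooth_on S (\<lambda>x. ricci G x v w)"
  unfolding ricci_def trace_matrix
  by (rule smooth_on_sum[OF S_open smooth_on_bounded_linear[OF S_open bounded_linear_vec_nth
        smooth_on_curvature[OF G]]])

lemma Dif_ricci:
  assumes x: "x \<in> S"
  shows "Dif (\<lambda>y. ricci G y v w) x z = trace (matrix (\<lambda>u. Dif (\<lambda>y. curvature G y u v w) x z))"
  unfolding ricci_def trace_matrix
  by (rule fun_cong[OF Dif_eqI], rule has_derivative_sum, rule bounded_linear.has_derivative[OF bounded_linear_vec_nth],
      rule has_derivative_Dif[OF smooth_on_differentiable_at[OF smooth_on_curvature[OF G] S_open x]])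

lemma ricci_E_right: "x \<in> S \<Longrightarrow> ricci G x v (E x) = 0"
  unfolding ricci_def trace_matrix by (simp add: curvature_E)

end

text \<open>The pointwise trace of the global hypotheses: planelike surfaces through every plane
  containing \<open>E\<close>, together with the vanishing one-form, make the curvature contracted
  with \<open>E\<close> take values in the line of \<open>E\<close>.\<close>

locale conelike_chart = radiant_chart S G E
  for S :: "(real^'n::finite) set" and G :: "'n christoffel" and E :: "real^'n \<Rightarrow> real^'n" +
  assumes E_nonzero: "\<And>x. x \<in> S \<Longrightarrow> E x \<noteq> 0"
    and curvature_E_vertical: "\<And>x v w. x \<in> S \<Longrightarrow> \<exists>r. curvature G x (E x) v w = r *\<^sub>R E x"
begin

text \<open>\<open>E\<^sup>p R\<^sub>p\<^sub>i\<^sub>j\<^sup>k = a\<^sub>i\<^sub>j E\<^sup>k\<close>.\<close>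

definition a :: "real^'n \<Rightarrow> real^'n \<Rightarrow> real^'n \<Rightarrow> real" where
  "a x v w = (curvature G x (E x) v w \<bullet> E x) / (E x \<bullet> E x)"

lemma curvature_E_eq:
  assumes x: "x \<in> S"
  shows "curvature G x (E x) v w = a x v w *\<^sub>R E x"
  using curvature_E_vertical[OF x, of v w] E_nonzero[OF x] by (auto simp: a_def)

lemma horizontal_a: "horizontal a"
  unfolding horizontal_def
proof (intro conjI ballI allI)
  show "bilinear (a x)" if x: "x \<in> S" for x
    unfolding bilinear_def a_def
    by (intro conjI allI linearI)
      (simp_all add: linear_add[OF curvature_linear(2)[OF G x]] linear_scale[OF curvature_linear(2)[OF G x]]
        linear_add[OF curvature_linear(3)[OF G x]] linear_scale[OF curvature_linear(3)[OF G x]]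
        inner_add_left add_divide_distrib)
  show "smooth_on S (\<lambda>x. a x v w)" for v w
  proof -
    have "smooth_on S (\<lambda>x. curvature G x (E x) v w)"
      by (rule smooth_on_linear_field[OF S_open curvature_linear(1)[OF G] smooth_on_curvature[OF G] E_smooth])
    then show ?thesis
      unfolding a_def
      by (rule smooth_on_divide[OF S_open smooth_on_inner[OF S_open _ E_smooth]
            smooth_on_inner[OF S_open E_smooth E_smooth]]) (simp add: E_nonzero)
  qed
  show "a x v w = a x w v" if "x \<in> S" for x v w
    using curvature_E_commute[OF that, of v w] by (simp add: a_def)
  show "a x (E x) w = 0" if "x \<in> S" for x w
    by (simp add: a_def curvature_same)
qed

text \<open>By skewness the traced map is the rank-one map \<open>- a x u w *\<^sub>R E x\<close>,
  and \<open>a\<close> annihilates \<open>E\<close>. This is what makes the symmetrized Ricci tensor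
  horizontal.\<close>

lemma ricci_E_left:
  assumes x: "x \<in> S"
  shows "ricci G x (E x) w = 0"
proof -
  have "ricci G x (E x) w = trace (matrix (\<lambda>u. - (a x u w *\<^sub>R E x)))"
    unfolding ricci_def by (simp add: curvature_skew[of G x _ "E x"] curvature_E_eq[OF x])
  also have "\<dots> = - a x (E x) w"
    by (simp add: trace_matrix_minus trace_matrix_rank_one[OF horizontal_linear_left[OF horizontal_a x]])
  finally show ?thesis
    by (simp add: horizontal_E[OF horizontal_a x])
qed

lemma horizontal_ricci_sym: "horizontal ricci_sym"
  unfolding horizontal_def
proof (intro conjI ballI allI)
  show "bilinear (ricci_sym x)" if x: "x \<in> S" for x
    unfolding bilinear_def ricci_sym_def
    by (intro conjI allI linearI)
      (simp_all add: linear_add[OF ricci_linear(1)[OF x]] linear_scale[OF ricci_linear(1)[OF x]]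
        linear_add[OF ricci_linear(2)[OF x]] linear_scale[OF ricci_linear(2)[OF x]] algebra_simps add_divide_distrib)
  show "smooth_on S (\<lambda>x. ricci_sym x v w)" for v w
    unfolding ricci_sym_def
    by (rule smooth_on_divide[OF S_open smooth_on_add[OF S_open smooth_on_ricci smooth_on_ricci] smooth_on_const])
      simp
  show "ricci_sym x v w = ricci_sym x w v" for x v w
    by (simp add: ricci_sym_def)
  show "ricci_sym x (E x) w = 0" if "x \<in> S" for x w
    by (simp add: ricci_sym_def ricci_E_left[OF that] ricci_E_right[OF that])
qed

text \<open>Differentiate \<open>curvature_E_eq\<close>. Freezing \<open>E\<close> at
  \<open>x\<close> in the first slot produces a term with \<open>Dif E x v\<close> there, which
  \<open>Dif_E\<close> converts into the last two curvature terms.\<close>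

lemma Dif_curvature_E:
  assumes x: "x \<in> S"
  shows "Dif (\<lambda>y. curvature G y (E x) w z) x v = Dif (\<lambda>y. a y w z) x v *\<^sub>R E x
    + a x w z *\<^sub>R (v - G x v (E x)) - curvature G x v w z + curvature G x (G x v (E x)) w z"
proof -
  have "Dif (\<lambda>y. curvature G y (E y) w z) x v = Dif (\<lambda>y. a y w z *\<^sub>R E y) x v"
    by (rule fun_cong[OF Dif_cong[OF S_open x]]) (rule curvature_E_eq)
  also have "\<dots> = a x w z *\<^sub>R Dif E x v + Dif (\<lambda>y. a y w z) x v *\<^sub>R E x"
    by (rule fun_cong[OF Dif_eqI], rule has_derivative_scaleR[OF horizontal_has_derivative[OF horizontal_a x]
        E_has_derivative[OF x]])
  also have "Dif (\<lambda>y. curvature G y (E y) w z) x v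
      = Dif (\<lambda>y. curvature G y (E x) w z) x v + curvature G x (Dif E x v) w z"
    by (rule fun_cong[OF Dif_eqI], rule has_derivative_linear_field[OF S_open x curvature_linear(1)[OF G]
        has_derivative_Dif[OF smooth_on_differentiable_at[OF smooth_on_curvature[OF G] S_open x]]
        E_has_derivative[OF x]])
  finally show ?thesis
    by (simp add: Dif_E[OF x] linear_diff[OF curvature_linear(1)[OF G x]] algebra_simps)
qed

text \<open>The second Bianchi identity with \<open>E\<close> in one of the cyclic slots.\<close>

lemma covariant_derivative_curvature_E:
  assumes x: "x \<in> S"
  shows "Dif (\<lambda>y. curvature G y v w z) x (E x) + G x (E x) (curvature G x v w z) - curvature G x v w (G x (E x) z)
    = (Dif (\<lambda>y. a y w z) x v - a x w (G x v z) - Dif (\<lambda>y. a y v z) x w + a x v (G x w z)) *\<^sub>R E x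
      + a x w z *\<^sub>R v - a x v z *\<^sub>R w - 2 *\<^sub>R curvature G x v w z
      + curvature G x (G x (E x) v) w z + curvature G x v (G x (E x) w) z"
proof -
  have neg: "Dif (\<lambda>y. curvature G y w (E x) z) x v = - Dif (\<lambda>y. curvature G y (E x) w z) x v"
  proof -
    have "Dif (\<lambda>y. - curvature G y (E x) w z) x v = - Dif (\<lambda>y. curvature G y (E x) w z) x v"
      by (rule fun_cong[OF Dif_eqI], rule has_derivative_minus,
          rule has_derivative_Dif[OF smooth_on_differentiable_at[OF smooth_on_curvature[OF G] S_open x]])
    then show ?thesis by (subst curvature_skew)
  qed
  note skew = curvature_skew[of G x w "E x"]
  note lin = linear_scale[OF christoffel_linear[OF G x]] linear_neg[OF christoffel_linear[OF G x]]
  have sw: "curvature G x w v z = - curvature G x v w z"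
    "curvature G x (G x (E x) w) v z = - curvature G x v (G x (E x) w) z"
    by (rule curvature_skew)+
  have bianchi: "(Dif (\<lambda>y. curvature G y v w z) x (E x) + G x (E x) (curvature G x v w z) - curvature G x v w (G x (E x) z))
    + (Dif (\<lambda>y. curvature G y w (E x) z) x v + G x v (curvature G x w (E x) z) - curvature G x w (E x) (G x v z))
    + (Dif (\<lambda>y. curvature G y (E x) v z) x w + G x w (curvature G x (E x) v z) - curvature G x (E x) v (G x w z)) = 0"
    using second_bianchi[OF G x, of "E x" v w z] by (simp add: covd_def)
  show ?thesis
    using bianchi
    unfolding neg Dif_curvature_E[OF x] skew curvature_E_eq[OF x] lin G_commute[OF x, of _ "E x"] sw
    by (simp add: algebra_simps scaleR_2)
qed

text \<open>Trace over \<open>v\<close> of the contracted Bianchi identity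
  \<open>covariant_derivative_curvature_E\<close>. Its term
  \<open>- 2 *\<^sub>R curvature G x v w z\<close> supplies the multiple of the Ricci tensor that
  turns a covariant derivative along \<open>E\<close> into a Lie derivative.\<close>

lemma lieE_ricci_sym:
  assumes x: "x \<in> S"
  shows "lieE ricci_sym x v w = lieE a x v w + (real CARD('n) - 2) * a x v w"
proof -
  have *: "Dif (\<lambda>y. ricci G y w z) x (E x) - ricci G x w (G x (E x) z) - ricci G x (G x (E x) w) z
      + 2 * ricci G x w z = lieE a x w z + (real CARD('n) - 2) * a x w z" for w z
  proof -
    define \<alpha> where "\<alpha> v = Dif (\<lambda>y. a y w z) x v - a x w (G x v z) - Dif (\<lambda>y. a y v z) x w + a x v (G x w z)" for v
    note A = horizontal_a
    have lin: "linear \<alpha>"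
      unfolding \<alpha>_def
      by (rule linearI; simp add: linear_add[OF horizontal_Dif_linear(1)[OF A x]]
          linear_scale[OF horizontal_Dif_linear(1)[OF A x]] linear_add[OF horizontal_Dif_linear(2)[OF A x]]
          linear_scale[OF horizontal_Dif_linear(2)[OF A x]] linear_add[OF horizontal_linear[OF A x]]
          linear_scale[OF horizontal_linear[OF A x]] linear_add[OF horizontal_linear_left[OF A x]]
          linear_scale[OF horizontal_linear_left[OF A x]] linear_add[OF christoffel_linear_left[OF G x]]
          linear_scale[OF christoffel_linear_left[OF G x]] algebra_simps)
    have "trace (matrix (\<lambda>v. Dif (\<lambda>y. curvature G y v w z) x (E x) + G x (E x) (curvature G x v w z)
        - curvature G x v w (G x (E x) z)))
      = trace (matrix (\<lambda>v. \<alpha> v *\<^sub>R E x + a x w z *\<^sub>R v - a x v z *\<^sub>R w - 2 *\<^sub>R curvature G x v w z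
      + curvature G x (G x (E x) v) w z + curvature G x v (G x (E x) w) z))"
      unfolding \<alpha>_def covariant_derivative_curvature_E[OF x] ..
    then have "Dif (\<lambda>y. ricci G y w z) x (E x) + trace (matrix (\<lambda>v. G x (E x) (curvature G x v w z)))
        - ricci G x w (G x (E x) z)
      = \<alpha> (E x) + a x w z * real CARD('n) - a x w z - 2 * ricci G x w z
      + trace (matrix (\<lambda>v. curvature G x (G x (E x) v) w z)) + ricci G x (G x (E x) w) z"
      by (simp only: trace_matrix_add trace_matrix_diff trace_matrix_rank_one[OF lin] trace_matrix_scale
        trace_matrix_id trace_matrix_rank_one[OF horizontal_linear_left[OF A x]] ricci_def[symmetric]
        Dif_ricci[OF x, symmetric])
    \<comment> \<open>The Christoffel terms acting on the two contracted indices cancel by cyclicity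
      of the trace.\<close>
    moreover have "trace (matrix (\<lambda>v. G x (E x) (curvature G x v w z)))
        = trace (matrix (\<lambda>v. curvature G x (G x (E x) v) w z))"
      by (rule trace_matrix_commute[OF christoffel_linear[OF G x] curvature_linear(1)[OF G x]])
    moreover have "\<alpha> (E x) = lieE a x w z - a x w z"
      unfolding \<alpha>_def lieE_def horizontal_Dif_E[OF A x] horizontal_E[OF A x] by simp
    ultimately show ?thesis by (simp add: algebra_simps)
  qed
  have ric: "((\<lambda>y. ricci G y v w) has_derivative Dif (\<lambda>y. ricci G y v w) x) (at x)" for v w
    by (rule has_derivative_Dif[OF smooth_on_differentiable_at[OF smooth_on_ricci S_open x]])
  have "Dif (\<lambda>y. (1 / 2) * (ricci G y v w + ricci G y w v)) x
      = (\<lambda>u. (1 / 2) * (Dif (\<lambda>y. ricci G y v w) x u + Dif (\<lambda>y. ricci G y w v) x u))"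
    by (rule Dif_eqI, rule has_derivative_mult_right[OF has_derivative_add[OF ric ric]])
  then have D: "Dif (\<lambda>y. ricci_sym y v w) x (E x)
      = (Dif (\<lambda>y. ricci G y v w) x (E x) + Dif (\<lambda>y. ricci G y w v) x (E x)) / 2"
    by (simp add: ricci_sym_def)
  show ?thesis
    using *[of v w] *[of w v] lieE_commute[OF horizontal_a x, of w v] horizontal_commute[OF horizontal_a x, of w v]
    unfolding lieE_def[of ricci_sym] D G_commute[OF x, of v "E x"]
    by (simp add: ricci_sym_def field_simps)
qed

text \<open>By \<open>lie_derivative_conn_modify\<close> and \<open>ricci_modify\<close>, adding \<open>P\<^sub>i\<^sub>j E\<^sup>k\<close> to \<open>\<nabla>\<close> makes the Lie derivative
  vanish iff \<open>lieE P = - a\<close>, and then makes the Ricci tensor skew iff \<open>P\<close> is the following tensor.\<close>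

definition correction :: "real^'n \<Rightarrow> real^'n \<Rightarrow> real^'n \<Rightarrow> real" where
  "correction x v w = (1 / (real CARD('n) - 2)) * (a x v w - ricci_sym x v w)"

lemma horizontal_correction: "horizontal correction"
  unfolding correction_def[abs_def] by (rule horizontal_combine[OF horizontal_a horizontal_ricci_sym])

text \<open>The terms \<open>lieE a\<close> cancel in the difference. What remains is
  \<open>- (n - 2) * a\<close>, and the normalizing factor was chosen to absorb
  \<open>n - 2\<close>.\<close>

lemma lieE_correction:
  assumes x: "x \<in> S" and n: "CARD('n) > 2"
  shows "lieE correction x v w = - a x v w"
proof -
  have "lieE correction x v w = (1 / (real CARD('n) - 2)) * (lieE a x v w - lieE ricci_sym x v w)"
    unfolding correction_def[abs_def] by (rule lieE_combine[OF horizontal_a horizontal_ricci_sym x])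
  moreover have "real CARD('n) - 2 \<noteq> 0"
    using n by linarith
  ultimately show ?thesis
    unfolding lieE_ricci_sym[OF x] by simp
qed

lemma lie_derivative_conn_correction:
  assumes x: "x \<in> S" and n: "CARD('n) > 2"
  shows "lie_derivative_conn (modify correction) E x v w = 0"
  unfolding lie_derivative_conn_modify[OF horizontal_correction x] lieE_correction[OF x n] curvature_E_eq[OF x]
  by simp

text \<open>The two added terms of \<open>ricci_modify\<close> are \<open>- a\<close> and
  \<open>a - ricci_sym\<close>; together they remove exactly the symmetric part.\<close>

lemma ricci_correction:
  assumes x: "x \<in> S" and n: "CARD('n) > 2"
  shows "ricci (modify correction) x v w = (ricci G x v w - ricci G x w v) / 2"
proof -
  have "(real CARD('n) - 2) * correction x v w = a x v w - ricci_sym x v w"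
    using n by (simp add: correction_def)
  then show ?thesis
    unfolding ricci_modify[OF horizontal_correction x] lieE_correction[OF x n]
    by (simp add: ricci_sym_def field_simps)
qed

end

section \<open>Tensors preserving the planes through the radiant direction\<close>

text \<open>If \<open>D(y,y) = \<alpha> e + \<beta> y\<close> then, by polarization, \<open>2 D(x,y) - \<beta> x\<close> lies in the span of \<open>e\<close> and
  \<open>y\<close> for all \<open>x\<close>. The endomorphism \<open>2 D(\<hyphen>,y) - \<beta> id\<close> maps \<open>e\<close> to \<open>-\<beta> e\<close> and \<open>y\<close> to \<open>\<beta> y\<close>
  modulo \<open>e\<close>, so it has trace zero, whence \<open>\<beta> = 0\<close>.\<close>

lemma scaleR_double:
  "(2 * r) *\<^sub>R z = r *\<^sub>R z + r *\<^sub>R z" "(r * 2) *\<^sub>R z = r *\<^sub>R z + r *\<^sub>R z"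
  for z :: "'v::real_vector"
  by (simp_all only: mult_2 mult_2_right scaleR_left_distrib)

lemma planar_polarization:
  fixes D :: "'v::real_vector \<Rightarrow> 'v \<Rightarrow> 'v"
  assumes D: "bilinear D" and sym: "\<And>v w. D v w = D w v" and De: "\<And>w. D e w = 0"
    and planar: "\<And>v. \<exists>p q. D v v = p *\<^sub>R e + q *\<^sub>R v"
    and y: "\<And>k. y \<noteq> k *\<^sub>R e" and Dyy: "D y y = \<alpha> *\<^sub>R e + \<beta> *\<^sub>R y"
  shows "\<exists>p q. 2 *\<^sub>R D x y - \<beta> *\<^sub>R x = p *\<^sub>R e + q *\<^sub>R y"
proof (cases "\<exists>s t. x = s *\<^sub>R e + t *\<^sub>R y")
  case True
  then obtain s t where x: "x = s *\<^sub>R e + t *\<^sub>R y" by blast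
  have "D x y = t *\<^sub>R D y y"
    unfolding x by (simp add: bilinear_ladd[OF D] bilinear_lmul[OF D] De)
  then have "2 *\<^sub>R D x y - \<beta> *\<^sub>R x = (t * \<alpha> + t * \<alpha> - \<beta> * s) *\<^sub>R e + (t * \<beta> + t * \<beta> - \<beta> * t) *\<^sub>R y"
    unfolding Dyy x by (simp only: scaleR_2 scaleR_add_right scaleR_add_left scaleR_diff_left scaleR_scaleR) (simp add: scaleR_double)
  then show ?thesis by blast
next
  case False
  obtain p1 q1 where 1: "D (x + y) (x + y) = p1 *\<^sub>R e + q1 *\<^sub>R (x + y)" using planar by blast
  obtain p2 q2 where 2: "D (x - y) (x - y) = p2 *\<^sub>R e + q2 *\<^sub>R (x - y)" using planar by blast
  obtain p3 q3 where 3: "D x x = p3 *\<^sub>R e + q3 *\<^sub>R x" using planar by blast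
  have e1: "D x x + D x y + D x y + D y y = p1 *\<^sub>R e + q1 *\<^sub>R (x + y)"
    using 1 sym[of y x] by (simp add: bilinear_ladd[OF D] bilinear_radd[OF D] algebra_simps)
  have e2: "D x x - D x y - D x y + D y y = p2 *\<^sub>R e + q2 *\<^sub>R (x - y)"
    using 2 sym[of y x] by (simp add: bilinear_lsub[OF D] bilinear_rsub[OF D] algebra_simps)
  \<comment> \<open>The parallelogram identity eliminates \<open>D x y\<close> and leaves a linear
    relation among \<open>e\<close>, \<open>x\<close> and \<open>y\<close>. As \<open>x\<close> is
    outside the span of \<open>e\<close> and \<open>y\<close>, and \<open>y\<close> outside that of
    \<open>e\<close>, the coefficients of \<open>x\<close> and then of \<open>y\<close>
    vanish.\<close>
  have "D x x + D x x + D y y + D y y = (p1 *\<^sub>R e + q1 *\<^sub>R (x + y)) + (p2 *\<^sub>R e + q2 *\<^sub>R (x - y))"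
    unfolding e1[symmetric] e2[symmetric] by simp
  then have lin: "(q1 + q2 - 2 * q3) *\<^sub>R x = (2 * p3 + 2 * \<alpha> - p1 - p2) *\<^sub>R e + (2 * \<beta> - q1 + q2) *\<^sub>R y"
    unfolding 3 Dyy by (simp add: algebra_simps scaleR_double)
  have q: "q1 + q2 = 2 * q3"
  proof (rule ccontr)
    assume "q1 + q2 \<noteq> 2 * q3"
    then have c: "q1 + q2 - 2 * q3 \<noteq> 0" by simp
    have "x = inverse (q1 + q2 - 2 * q3) *\<^sub>R ((q1 + q2 - 2 * q3) *\<^sub>R x)"
      using c by simp
    also have "\<dots> = (inverse (q1 + q2 - 2 * q3) * (2 * p3 + 2 * \<alpha> - p1 - p2)) *\<^sub>R e
        + (inverse (q1 + q2 - 2 * q3) * (2 * \<beta> - q1 + q2)) *\<^sub>R y"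
      unfolding lin by (simp add: scaleR_add_right)
    finally show False using False by blast
  qed
  have "q1 - q2 = 2 * \<beta>"
  proof (rule ccontr)
    define c d where "c = 2 * \<beta> - q1 + q2" and "d = 2 * p3 + 2 * \<alpha> - p1 - p2"
    assume "q1 - q2 \<noteq> 2 * \<beta>"
    then have c: "c \<noteq> 0" by (simp add: c_def)
    have "d *\<^sub>R e + c *\<^sub>R y = 0"
      using lin q unfolding c_def[symmetric] d_def[symmetric] by simp
    then have "c *\<^sub>R y = (- d) *\<^sub>R e"
      by (simp add: eq_neg_iff_add_eq_0 add.commute)
    then have "inverse c *\<^sub>R (c *\<^sub>R y) = inverse c *\<^sub>R ((- d) *\<^sub>R e)"
      by (rule arg_cong)
    then have "y = (inverse c * (- d)) *\<^sub>R e"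
      using c by simp
    then show False using y by blast
  qed
  with q have b: "q1 = q3 + \<beta>" by simp
  have "2 *\<^sub>R D x y = (p1 *\<^sub>R e + q1 *\<^sub>R (x + y)) - D x x - D y y"
    unfolding e1[symmetric] by (simp add: scaleR_2)
  then have "2 *\<^sub>R D x y - \<beta> *\<^sub>R x = (p1 - p3 - \<alpha>) *\<^sub>R e + (q1 - \<beta>) *\<^sub>R y"
    unfolding 3 Dyy b by (simp add: algebra_simps)
  then show ?thesis by blast
qed

lemma planar_imp_vertical:
  fixes D :: "real^'n::finite \<Rightarrow> real^'n \<Rightarrow> real^'n"
  assumes D: "bilinear D" and sym: "\<And>v w. D v w = D w v" and De: "\<And>w. D e w = 0" and e: "e \<noteq> 0"
    and planar: "\<And>v. \<exists>p q. D v v = p *\<^sub>R e + q *\<^sub>R v"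
    and tr: "\<And>v. trace (matrix (D v)) = 0"
  shows "\<exists>r. D v w = r *\<^sub>R e"
proof -
  have diag: "\<exists>r. D v v = r *\<^sub>R e" for v
  proof (cases "\<exists>k. v = k *\<^sub>R e")
    case True
    then obtain k where "v = k *\<^sub>R e" by blast
    then have "D v v = 0 *\<^sub>R e" by (simp add: bilinear_lmul[OF D] De)
    then show ?thesis by blast
  next
    case False
    \<comment> \<open>Since \<open>D\<close> annihilates \<open>e\<close>, only \<open>v\<close>
      modulo \<open>e\<close> matters. The representative orthogonal to \<open>e\<close> makes the
      coefficients of \<open>T x\<close> explicit linear functionals, so that \<open>T\<close> is a
      sum of two rank-one maps.\<close>
    define k where "k = (v \<bullet> e) / (e \<bullet> e)"
    define y where "y = v - k *\<^sub>R e"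
    have ye: "y \<bullet> e = 0" using e by (simp add: y_def k_def inner_diff_left)
    have y: "y \<noteq> s *\<^sub>R e" for s
    proof
      assume "y = s *\<^sub>R e"
      then have "v = (s + k) *\<^sub>R e" by (simp add: y_def diff_eq_eq scaleR_left_distrib)
      then show False using False by blast
    qed
    from y[of 0] have y0: "y \<noteq> 0" by simp
    have Dvv: "D v v = D y y"
      unfolding y_def by (simp add: bilinear_lsub[OF D] bilinear_rsub[OF D] bilinear_lmul[OF D] De
          bilinear_rmul[OF D] sym[of v e])
    obtain \<alpha> \<beta> where Dyy: "D y y = \<alpha> *\<^sub>R e + \<beta> *\<^sub>R y" using planar by blast
    define T where "T x = 2 *\<^sub>R D y x - \<beta> *\<^sub>R x" for x
    have linT: "linear T"
      unfolding T_def by (rule linearI) (simp_all add: bilinear_radd[OF D] bilinear_rmul[OF D] algebra_simps)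
    have T: "T x = ((T x \<bullet> e) / (e \<bullet> e)) *\<^sub>R e + ((T x \<bullet> y) / (y \<bullet> y)) *\<^sub>R y" for x
    proof -
      obtain p q where pq: "T x = p *\<^sub>R e + q *\<^sub>R y"
        using planar_polarization[OF D sym De planar y Dyy, of x] unfolding T_def sym[of y x] by blast
      then show ?thesis using e y0 ye by (simp add: inner_add_left inner_commute[of e y])
    qed
    have l1: "linear (\<lambda>x. (T x \<bullet> e) / (e \<bullet> e))"
      by (rule linearI) (simp_all add: linear_add[OF linT] linear_scale[OF linT] inner_add_left add_divide_distrib)
    have l2: "linear (\<lambda>x. (T x \<bullet> y) / (y \<bullet> y))"
      by (rule linearI) (simp_all add: linear_add[OF linT] linear_scale[OF linT] inner_add_left add_divide_distrib)
    have "trace (matrix T) = trace (matrix (\<lambda>x. ((T x \<bullet> e) / (e \<bullet> e)) *\<^sub>R e + ((T x \<bullet> y) / (y \<bullet> y)) *\<^sub>R y))"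
      using T by simp
    also have "\<dots> = (T e \<bullet> e) / (e \<bullet> e) + (T y \<bullet> y) / (y \<bullet> y)"
      by (simp only: trace_matrix_add trace_matrix_rank_one[OF l1] trace_matrix_rank_one[OF l2])
    also have "T e = (- \<beta>) *\<^sub>R e"
      by (simp add: T_def sym[of y e] De)
    also have "T y = (2 * \<alpha>) *\<^sub>R e + \<beta> *\<^sub>R y"
      by (simp add: T_def Dyy scaleR_2 scaleR_double)
    finally have "trace (matrix T) = 0"
      using e y0 ye by (simp add: inner_add_left inner_commute[of e y])
    moreover have "trace (matrix T) = - (\<beta> * real CARD('n))"
      unfolding T_def by (simp add: trace_matrix_diff trace_matrix_scale trace_matrix_id tr)
    ultimately have "\<beta> = 0" by simp
    then show ?thesis using Dvv Dyy by auto
  qed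
  obtain r1 r2 r3 where r: "D (v + w) (v + w) = r1 *\<^sub>R e" "D v v = r2 *\<^sub>R e" "D w w = r3 *\<^sub>R e"
    using diag by meson
  have "2 *\<^sub>R D v w = D (v + w) (v + w) - D v v - D w w"
    by (simp add: bilinear_ladd[OF D] bilinear_radd[OF D] sym[of w v] scaleR_2)
  also have "\<dots> = (r1 - r2 - r3) *\<^sub>R e"
    unfolding r by (simp add: scaleR_diff_left)
  finally have "(1 / 2) *\<^sub>R (2 *\<^sub>R D v w) = (1 / 2) *\<^sub>R ((r1 - r2 - r3) *\<^sub>R e)" by (rule arg_cong)
  then have "D v w = ((r1 - r2 - r3) / 2) *\<^sub>R e" by simp
  then show ?thesis by blast
qed

section \<open>Uniqueness and naturality of the modification in charts\<close>

lemma curvature_cong: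
  assumes "open S" "x \<in> S" "\<And>y. y \<in> S \<Longrightarrow> G y = G' y"
  shows "curvature G x u v w = curvature G' x u v w"
proof -
  have "Dif (\<lambda>y. G y v w) x = Dif (\<lambda>y. G' y v w) x" for v w
    by (rule Dif_cong[OF assms(1,2)]) (simp add: assms(3))
  then show ?thesis
    unfolding curvature_eq by (simp add: assms(2,3))
qed

lemma ricci_cong:
  assumes "open S" "x \<in> S" "\<And>y. y \<in> S \<Longrightarrow> G y = G' y"
  shows "ricci G x v w = ricci G' x v w"
proof -
  have "(\<lambda>u. curvature G x u v w) = (\<lambda>u. curvature G' x u v w)"
    by (rule ext) (rule curvature_cong[OF assms])
  then show ?thesis by (simp add: ricci_def)
qed

text \<open>Both connections are already modifications, and they are compared with each other. The
  difference is some \<open>P\<close> times \<open>E\<close>; invariance of both gives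
  \<open>lieE P = 0\<close>, so the Ricci tensors differ by \<open>(n - 2) * P\<close>, which is
  symmetric and skew at once.\<close>

lemma (in radiant_chart) modification_unique:
  assumes R': "radiant_chart S G' E" and E_nz: "\<And>x. x \<in> S \<Longrightarrow> E x \<noteq> 0" and n: "CARD('n) > 2"
    and planar: "\<And>x v. x \<in> S \<Longrightarrow> \<exists>p q. G' x v v - G x v v = p *\<^sub>R E x + q *\<^sub>R v"
    and tr: "\<And>x v. x \<in> S \<Longrightarrow> trace (matrix (G' x v)) = trace (matrix (G x v))"
    and inv: "\<And>x v w. x \<in> S \<Longrightarrow> lie_derivative_conn G E x v w = 0"
      "\<And>x v w. x \<in> S \<Longrightarrow> lie_derivative_conn G' E x v w = 0"
    and ric: "\<And>x v w. x \<in> S \<Longrightarrow> ricci G x v w = - ricci G x w v"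
      "\<And>x v w. x \<in> S \<Longrightarrow> ricci G' x v w = - ricci G' x w v"
    and x: "x \<in> S"
  shows "G' x = G x"
proof -
  interpret R': radiant_chart S G' E by (rule R')
  define D where "D x v w = G' x v w - G x v w" for x v w
  define P where "P x v w = (D x v w \<bullet> E x) / (E x \<bullet> E x)" for x v w
  have D_bil: "bilinear (D x)" if x: "x \<in> S" for x
    unfolding bilinear_def D_def
    by (intro conjI allI linearI)
      (simp_all add: linear_add[OF christoffel_linear[OF G x]] linear_scale[OF christoffel_linear[OF G x]]
        linear_add[OF christoffel_linear_left[OF G x]] linear_scale[OF christoffel_linear_left[OF G x]]
        linear_add[OF christoffel_linear[OF R'.G x]] linear_scale[OF christoffel_linear[OF R'.G x]]
        linear_add[OF christoffel_linear_left[OF R'.G x]] linear_scale[OF christoffel_linear_left[OF R'.G x]]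
        algebra_simps)
  have D_sym: "D x v w = D x w v" if "x \<in> S" for x v w
    using G_commute[OF that, of v w] R'.G_commute[OF that, of v w] by (simp add: D_def)
  \<comment> \<open>The radiant condition expresses \<open>G x w (E x)\<close> through the
    derivative of the common field \<open>E\<close>.\<close>
  have D_E: "D x (E x) w = 0" if "x \<in> S" for x w
    using Dif_E[OF that, of w] R'.Dif_E[OF that, of w] D_sym[OF that, of "E x" w] by (simp add: D_def)
  have D_P: "D x v w = P x v w *\<^sub>R E x" if x: "x \<in> S" for x v w
  proof -
    have "trace (matrix (D x v)) = 0" for v
      unfolding D_def by (simp add: trace_matrix_diff tr[OF x])
    then have "\<exists>r. D x v w = r *\<^sub>R E x"
      using planar[OF x] unfolding D_def[symmetric]
      by (intro planar_imp_vertical[OF D_bil[OF x] D_sym[OF x] D_E[OF x] E_nz[OF x]]) auto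
    then show ?thesis using E_nz[OF x] by (auto simp: P_def)
  qed
  have P: "horizontal P"
    unfolding horizontal_def
  proof (intro conjI ballI allI)
    show "bilinear (P x)" if x: "x \<in> S" for x
      unfolding bilinear_def P_def
      by (intro conjI allI linearI)
        (simp_all add: bilinear_ladd[OF D_bil[OF x]] bilinear_lmul[OF D_bil[OF x]]
          bilinear_radd[OF D_bil[OF x]] bilinear_rmul[OF D_bil[OF x]] inner_add_left add_divide_distrib)
    show "smooth_on S (\<lambda>x. P x v w)" for v w
      unfolding P_def D_def
      by (rule smooth_on_divide[OF S_open smooth_on_inner[OF S_open
              smooth_on_diff[OF S_open christoffel_smooth[OF R'.G] christoffel_smooth[OF G]] E_smooth]
            smooth_on_inner[OF S_open E_smooth E_smooth]]) (simp add: E_nz)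
    show "P x v w = P x w v" if "x \<in> S" for x v w
      using D_sym[OF that, of v w] by (simp add: P_def)
    show "P x (E x) w = 0" if "x \<in> S" for x w
      using D_E[OF that] by (simp add: P_def)
  qed
  have G': "G' y = modify P y" if "y \<in> S" for y
    using D_P[OF that] by (intro ext) (simp add: modify_def D_def diff_eq_eq add.commute)
  have lie: "lieE P x v w = 0" for v w
  proof -
    have "lie_derivative_conn (modify P) E x v w = lie_derivative_conn G' E x v w"
      unfolding R'.lie_derivative_conn_eq_curvature[OF x]
        radiant_chart.lie_derivative_conn_eq_curvature[OF radiant_chart_modify[OF P] x]
      by (rule curvature_cong[OF S_open x, symmetric]) (rule G')
    then show ?thesis
      using lie_derivative_conn_modify[OF P x, of v w] lie_derivative_conn_eq_curvature[OF x, of v w]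
        inv[OF x] E_nz[OF x] by simp
  qed
  have ric': "ricci G' x v w = ricci G x v w + (real CARD('n) - 2) * P x v w" for v w
  proof -
    have "ricci G' x v w = ricci (modify P) x v w"
      by (rule ricci_cong[OF S_open x G'])
    then show ?thesis
      using ricci_modify[OF P x, of v w] lie by simp
  qed
  have "P x v w = 0" for v w
  proof -
    have "(real CARD('n) - 2) * P x v w = 0"
      using ric'[of v w] ric'[of w v, unfolded horizontal_commute[OF P x, of w v]] ric(1)[OF x, of v w]
        ric(2)[OF x, of v w] by linarith
    then show ?thesis using n by simp
  qed
  then show ?thesis
    using D_P[OF x] by (intro ext) (simp add: D_def)
qed

text \<open>The common setting for changes of coordinates and for automorphisms written in
  charts.\<close>

locale conelike_chart_map =
  C: conelike_chart S G E + C': conelike_chart S' G' E'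
  for S :: "(real^'n::finite) set" and G :: "'n christoffel" and E :: "real^'n \<Rightarrow> real^'n"
    and S' :: "(real^'n) set" and G' :: "'n christoffel" and E' :: "real^'n \<Rightarrow> real^'n" +
  fixes U :: "(real^'n) set" and h :: "real^'n \<Rightarrow> real^'n"
  assumes U: "open U" "U \<subseteq> S" and h: "smooth_on U h" and h_in: "\<And>y. y \<in> U \<Longrightarrow> h y \<in> S'"
    and affine: "\<And>y. y \<in> U \<Longrightarrow> affine_at G G' h y"
    and E_related: "\<And>y. y \<in> U \<Longrightarrow> E' (h y) = Dif h y (E y)"
    and invertible: "\<And>y. y \<in> U \<Longrightarrow> \<exists>k. linear k \<and> (\<forall>v. k (Dif h y v) = v) \<and> (\<forall>v. Dif h y (k v) = v)"
begin

lemma curvature_natural: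
  "x \<in> U \<Longrightarrow> Dif h x (curvature G x u v w) = curvature G' (h x) (Dif h x u) (Dif h x v) (Dif h x w)"
  by (rule curvature_affine[OF C.G C'.G U _ h h_in affine])

lemma a_natural:
  assumes x: "x \<in> U"
  shows "C'.a (h x) (Dif h x v) (Dif h x w) = C.a x v w"
proof -
  have xS: "x \<in> S" using U x by blast
  have "C'.a (h x) (Dif h x v) (Dif h x w) *\<^sub>R E' (h x) = Dif h x (curvature G x (E x) v w)"
    using C'.curvature_E_eq[OF h_in[OF x], of "Dif h x v" "Dif h x w"] curvature_natural[OF x, of "E x" v w]
      E_related[OF x] by simp
  also have "\<dots> = C.a x v w *\<^sub>R E' (h x)"
    unfolding C.curvature_E_eq[OF xS] E_related[OF x]
    by (rule linear_scale[OF linear_Dif[OF h U(1) x]])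
  finally show ?thesis
    using C'.E_nonzero[OF h_in[OF x]] by simp
qed

text \<open>The trace is invariant under conjugation; this is where an inverse \<open>k\<close> of
  the derivative enters.\<close>

lemma ricci_natural:
  assumes x: "x \<in> U"
  shows "ricci G' (h x) (Dif h x v) (Dif h x w) = ricci G x v w"
proof -
  have xS: "x \<in> S" using U x by blast
  obtain k where k: "linear k" "\<And>v. k (Dif h x v) = v" "\<And>v. Dif h x (k v) = v"
    using invertible[OF x] by blast
  have lin: "linear (\<lambda>u. curvature G x (k u) v w)"
    using linear_compose[OF k(1) curvature_linear(1)[OF C.G xS]] by (simp add: o_def)
  have "ricci G' (h x) (Dif h x v) (Dif h x w) = trace (matrix (\<lambda>u. Dif h x (curvature G x (k u) v w)))"
    unfolding ricci_def curvature_natural[OF x] k(3) ..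
  also have "\<dots> = trace (matrix (\<lambda>u. curvature G x (k (Dif h x u)) v w))"
    by (rule trace_matrix_commute[OF linear_Dif[OF h U(1) x] lin])
  finally show ?thesis
    unfolding k(2) ricci_def .
qed

lemma affine_at_modify_correction:
  assumes x: "x \<in> U"
  shows "affine_at (C.modify C.correction) (C'.modify C'.correction) h x"
proof -
  note lin = linear_Dif[OF h U(1) x]
  have "C'.correction (h x) (Dif h x v) (Dif h x w) = C.correction x v w" for v w
    unfolding C.correction_def C'.correction_def C.ricci_sym_def C'.ricci_sym_def a_natural[OF x] ricci_natural[OF x] ..
  then show ?thesis
    using affine[OF x] unfolding affine_at_def C.modify_def C'.modify_def
    by (simp add: E_related[OF x] linear_add[OF lin] linear_scale[OF lin])
qed

end

section \<open>Charts\<close>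

context
  fixes X :: "'a topology" and c :: "('a, 'v::real_normed_vector) chart"
  assumes c: "is_chart X c"
begin

lemma chart_dom_open: "openin X (chart_dom c)" and chart_img_open: "open (chart_img c)"
  using c by (simp_all add: is_chart_def)

lemma chart_dom_subset: "chart_dom c \<subseteq> topspace X"
  by (rule openin_subset[OF chart_dom_open])

lemma chart_inj: "inj_on (chart_map c) (chart_dom c)"
  using c homeomorphic_imp_injective_map[of "subtopology X (chart_dom c)" _ "chart_map c"] chart_dom_subset
  by (auto simp: is_chart_def topspace_subtopology Int_absorb1)

lemma chart_inv_map: "p \<in> chart_dom c \<Longrightarrow> chart_inv c (chart_map c p) = p"
  unfolding chart_inv_def by (rule inv_into_f_f[OF chart_inj])

lemma chart_inv_dom: "x \<in> chart_img c \<Longrightarrow> chart_inv c x \<in> chart_dom c"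
  unfolding chart_inv_def chart_img_def by (rule inv_into_into)

lemma chart_map_inv: "x \<in> chart_img c \<Longrightarrow> chart_map c (chart_inv c x) = x"
  unfolding chart_inv_def chart_img_def by (rule f_inv_into_f)

lemma loc_dom_iff: "x \<in> loc_dom c d f \<longleftrightarrow> x \<in> chart_img c \<and> f (chart_inv c x) \<in> chart_dom d"
proof
  assume "x \<in> loc_dom c d f"
  then obtain p where "p \<in> chart_dom c" "f p \<in> chart_dom d" "x = chart_map c p"
    unfolding loc_dom_def by blast
  then show "x \<in> chart_img c \<and> f (chart_inv c x) \<in> chart_dom d"
    by (simp add: chart_inv_map chart_img_def)
next
  assume "x \<in> chart_img c \<and> f (chart_inv c x) \<in> chart_dom d"
  then show "x \<in> loc_dom c d f"
    unfolding loc_dom_def using chart_inv_dom[of x] chart_map_inv[of x] by (metis (mono_tags, lifting) image_eqI mem_Collect_eq)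
qed

lemma loc_dom_subset: "loc_dom c d f \<subseteq> chart_img c"
  using loc_dom_iff by blast

lemma loc_map_in: "x \<in> loc_dom c d f \<Longrightarrow> loc_map c d f x \<in> chart_img d"
  unfolding loc_dom_iff by (simp add: loc_map_def chart_img_def)

end

lemma open_loc_dom:
  assumes c: "is_chart X c" and d: "is_chart Y d" and f: "continuous_map X Y f"
  shows "open (loc_dom c d f)"
proof -
  define V where "V = {p \<in> chart_dom c. f p \<in> chart_dom d}"
  have "openin X (chart_dom c \<inter> {p \<in> topspace X. f p \<in> chart_dom d})"
    by (rule openin_Int[OF chart_dom_open[OF c] openin_continuous_map_preimage[OF f chart_dom_open[OF d]]])
  moreover have "chart_dom c \<inter> {p \<in> topspace X. f p \<in> chart_dom d} = V"
    unfolding V_def using chart_dom_subset[OF c] by blast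
  ultimately have "openin X V" by simp
  moreover have "V \<subseteq> chart_dom c"
    unfolding V_def by blast
  ultimately have "openin (subtopology X (chart_dom c)) V"
    using openin_open_subtopology[OF chart_dom_open[OF c]] by blast
  moreover have "open_map (subtopology X (chart_dom c)) (top_of_set (chart_img c)) (chart_map c)"
    using c homeomorphic_imp_open_map unfolding is_chart_def by blast
  ultimately have "openin (top_of_set (chart_img c)) (chart_map c ` V)"
    unfolding open_map_def by blast
  then show ?thesis
    using openin_open_trans[OF _ chart_img_open[OF c]] unfolding loc_dom_def V_def by blast
qed

lemma loc_map_left_inverse:
  assumes c: "is_chart X c" and d: "is_chart Y d" and gf: "\<forall>p\<in>topspace X. g (f p) = p"
    and x: "x \<in> loc_dom c d f"
  shows "loc_map d c g (loc_map c d f x) = x" "loc_map c d f x \<in> loc_dom d c g"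
proof -
  let ?p = "chart_inv c x"
  have x': "x \<in> chart_img c" "f ?p \<in> chart_dom d"
    using x unfolding loc_dom_iff[OF c] by auto
  have p: "?p \<in> chart_dom c" by (rule chart_inv_dom[OF c x'(1)])
  then have "g (f ?p) = ?p"
    using gf chart_dom_subset[OF c] by blast
  then show "loc_map d c g (loc_map c d f x) = x"
    by (simp add: loc_map_def chart_inv_map[OF d x'(2)] chart_map_inv[OF c x'(1)])
  show "loc_map c d f x \<in> loc_dom d c g"
    unfolding loc_dom_iff[OF d] using loc_map_in[OF c x] \<open>g (f ?p) = ?p\<close> p
    by (simp add: loc_map_def chart_inv_map[OF d x'(2)])
qed

lemma loc_map_smooth: "smooth_map X A Y B f \<Longrightarrow> c \<in> A \<Longrightarrow> d \<in> B \<Longrightarrow> smooth_on (loc_dom c d f) (loc_map c d f)"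
  unfolding smooth_map_def by blast

lemma Dif_loc_map_left_inverse:
  assumes c: "is_chart X c" "c \<in> A" and d: "is_chart Y d" "d \<in> B"
    and f: "smooth_map X A Y B f" and g: "smooth_map Y B X A g"
    and gf: "\<forall>p\<in>topspace X. g (f p) = p" and x: "x \<in> loc_dom c d f"
  shows "Dif (loc_map d c g) (loc_map c d f x) (Dif (loc_map c d f) x v) = v"
proof -
  have f': "continuous_map X Y f" and g': "continuous_map Y X g"
    using f g unfolding smooth_map_def by blast+
  note opf = open_loc_dom[OF c(1) d(1) f'] and opg = open_loc_dom[OF d(1) c(1) g']
  note inv = loc_map_left_inverse[OF c(1) d(1) gf]
  have "((\<lambda>y. loc_map d c g (loc_map c d f y)) has_derivative
      (\<lambda>v. Dif (loc_map d c g) (loc_map c d f x) (Dif (loc_map c d f) x v))) (at x)"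
    by (rule has_derivative_compose[OF has_derivative_Dif has_derivative_Dif];
        rule smooth_on_differentiable_at[OF loc_map_smooth])
      (fact f c d g opf x opg inv(2)[OF x])+
  from has_derivative_transform_within_open[OF this opf x, of "\<lambda>y. y"]
  have "((\<lambda>y. y) has_derivative
      (\<lambda>v. Dif (loc_map d c g) (loc_map c d f x) (Dif (loc_map c d f) x v))) (at x)"
    by (simp add: inv(1))
  from fun_cong[OF Dif_eqI[OF this], of v] show ?thesis by simp
qed

lemma structure_chart: "smooth_structure X A \<Longrightarrow> c \<in> A \<Longrightarrow> is_chart X c"
  unfolding smooth_structure_def by blast

lemma diffeomorphism_Dif_invertible:
  assumes X: "smooth_structure X A" and g: "diffeomorphism X A g" and cd: "c \<in> A" "d \<in> A"
    and x: "x \<in> loc_dom c d g"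
  shows "\<exists>k. linear k \<and> (\<forall>v. k (Dif (loc_map c d g) x v) = v) \<and> (\<forall>v. Dif (loc_map c d g) x (k v) = v)"
proof -
  obtain g' where g': "smooth_map X A X A g'" and inv: "\<forall>p\<in>topspace X. g' (g p) = p"
      "\<forall>p\<in>topspace X. g (g' p) = p" and g: "smooth_map X A X A g"
    using g unfolding diffeomorphism_def by blast
  note c = structure_chart[OF X cd(1)] cd(1) and d = structure_chart[OF X cd(2)] cd(2)
  note y = loc_map_left_inverse[OF c(1) d(1) inv(1) x]
  have g'_cont: "continuous_map X X g'" using g' unfolding smooth_map_def by blast
  have "linear (Dif (loc_map d c g') (loc_map c d g x))"
    by (rule linear_Dif[OF loc_map_smooth[OF g' cd(2,1)] open_loc_dom[OF d(1) c(1) g'_cont] y(2)])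
  moreover have "Dif (loc_map d c g') (loc_map c d g x) (Dif (loc_map c d g) x v) = v" for v
    by (rule Dif_loc_map_left_inverse[OF c d g g' inv(1) x])
  moreover have "Dif (loc_map c d g) x (Dif (loc_map d c g') (loc_map c d g x) v) = v" for v
    using Dif_loc_map_left_inverse[OF d c g' g inv(2) y(2), of v] unfolding y(1) .
  ultimately show ?thesis by blast
qed

section \<open>Planelike surfaces\<close>

lemma radiant_chart_of_structure:
  assumes "radiant_structure A \<Gamma> E" "c \<in> A" "is_chart X c"
  shows "radiant_chart (chart_img c) (\<Gamma> c) (E c)"
  using assms chart_img_open[OF assms(3)]
  by (simp add: radiant_chart_def christoffel_on_def radiant_structure_def affine_connection_def
      torsion_free_def smooth_vector_field_def)

text \<open>The content of \<open>planelike\<close> in a pair of charts, with total geodesy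
  specialized to constant parameter fields, as \<open>curvature_tangent\<close> takes it.\<close>

lemma planelike_surface:
  assumes f: "planelike X A \<Gamma> E S B f" and X: "smooth_structure X A" and b: "b \<in> B" and c: "c \<in> A"
  defines "h \<equiv> loc_map b c f" and "U \<equiv> loc_dom b c f"
  shows "open U" "smooth_on U h" "t \<in> U \<Longrightarrow> h t \<in> chart_img c" "t \<in> U \<Longrightarrow> inj (Dif h t)"
    "t \<in> U \<Longrightarrow> covd_along (\<Gamma> c) h w (\<lambda>t. Dif h t y) t \<in> range (Dif h t)"
    "t \<in> U \<Longrightarrow> E c (h t) \<in> range (Dif h t)" "t \<in> U \<Longrightarrow> subspace (range (Dif h t))"
proof -
  have f': "smooth_map S B X A f" and S: "smooth_structure S B" and cont: "continuous_map S X f"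
    using f unfolding planelike_def smooth_immersion_def smooth_manifold_def smooth_map_def by blast+
  show op: "open U" unfolding U_def
    by (rule open_loc_dom[OF structure_chart[OF S b] structure_chart[OF X c] cont])
  show sm: "smooth_on U h" unfolding U_def h_def by (rule loc_map_smooth[OF f' b c])
  show "h t \<in> chart_img c" if "t \<in> U"
    using that unfolding U_def h_def by (rule loc_map_in[OF structure_chart[OF S b]])
  show "inj (Dif h t)" if "t \<in> U"
    using that f b c unfolding U_def h_def planelike_def smooth_immersion_def by blast
  show "covd_along (\<Gamma> c) h w (\<lambda>t. Dif h t y) t \<in> range (Dif h t)" if t: "t \<in> U"
  proof -
    have "\<forall>Y. smooth_on U Y \<longrightarrow> (\<forall>u\<in>U. \<forall>w.
           covd_along (\<Gamma> c) h w (\<lambda>t. Dif h t (Y t)) u \<in> range (Dif h u))"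
      using f b c unfolding U_def h_def planelike_def totally_geodesic_def by blast
    from this[rule_format, of "\<lambda>_. y", OF smooth_on_const t] show ?thesis .
  qed
  show "E c (h t) \<in> range (Dif h t)" if "t \<in> U"
    using that f b c unfolding U_def h_def planelike_def by blast
  show "subspace (range (Dif h t))" if "t \<in> U"
    by (rule linear_subspace_image[OF linear_Dif[OF sm op that] subspace_UNIV])
qed

text \<open>Covariant derivatives along the surface change by multiples of \<open>E\<close>, which
  is tangent to it. The condition \<open>vert\<close> is symmetric in the two connections, so the
  lemma serves in both directions.\<close>

lemma planelike_transfer:
  assumes f: "planelike X A \<Gamma> E S B f" and X: "smooth_structure X A"
    and vert: "\<And>c x v w. c \<in> A \<Longrightarrow> x \<in> chart_img c \<Longrightarrow> \<exists>r. \<Gamma>' c x v w = \<Gamma> c x v w + r *\<^sub>R E c x"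
  shows "planelike X A \<Gamma>' E S B f"
proof -
  have "totally_geodesic A \<Gamma>' B f"
    unfolding totally_geodesic_def
  proof (intro ballI allI impI)
    fix b c and Y :: "real^2 \<Rightarrow> real^2" and u w
    assume b: "b \<in> B" and c: "c \<in> A" and Y: "smooth_on (loc_dom b c f) Y" and u: "u \<in> loc_dom b c f"
    let ?h = "loc_map b c f"
    note surf = planelike_surface[OF f X b c]
    obtain r where "\<Gamma>' c (?h u) (Dif ?h u w) (Dif ?h u (Y u))
        = \<Gamma> c (?h u) (Dif ?h u w) (Dif ?h u (Y u)) + r *\<^sub>R E c (?h u)"
      using vert[OF c surf(3)[OF u]] by blast
    then have "covd_along (\<Gamma>' c) ?h w (\<lambda>t. Dif ?h t (Y t)) u
        = covd_along (\<Gamma> c) ?h w (\<lambda>t. Dif ?h t (Y t)) u + r *\<^sub>R E c (?h u)"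
      by (simp add: covd_along_def)
    moreover have "covd_along (\<Gamma> c) ?h w (\<lambda>t. Dif ?h t (Y t)) u \<in> range (Dif ?h u)"
      using f b c Y u unfolding planelike_def totally_geodesic_def by blast
    ultimately show "covd_along (\<Gamma>' c) ?h w (\<lambda>t. Dif ?h t (Y t)) u \<in> range (Dif ?h u)"
      using subspace_add[OF surf(7)[OF u] _ subspace_scale[OF surf(7)[OF u] surf(6)[OF u]]] by simp
  qed
  then show ?thesis
    using f unfolding planelike_def by blast
qed

text \<open>For the plane spanned by \<open>E\<close> and \<open>v\<close>, tangency to the surface
  becomes the existence of coefficients, the form in which \<open>planar_imp_vertical\<close> takes
  it.\<close>

lemma conelike_surface:
  assumes con: "conelike X A \<Gamma> E" and c: "c \<in> A" and x: "x \<in> chart_img c" and E: "E c x \<noteq> 0"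
    and v: "\<And>k. v \<noteq> k *\<^sub>R E c x"
  obtains S B f b u where "planelike X A \<Gamma> E S B f" "b \<in> B" "u \<in> loc_dom b c f" "loc_map b c f u = x"
    "range (Dif (loc_map b c f) u) = {p *\<^sub>R E c x + q *\<^sub>R v | p q. True}"
proof -
  let ?L = "span {v, E c x}"
  have "v \<notin> span {E c x}" using v by (auto simp: span_singleton)
  then have "independent {v, E c x}" using E by (simp add: independent_insert)
  moreover have "v \<noteq> E c x" using v[of 1] by simp
  ultimately have "dim ?L = 2"
    by (simp add: dim_span dim_eq_card_independent)
  moreover have "subspace ?L" "E c x \<in> ?L"
    by (auto intro: subspace_span span_base)
  ultimately obtain S B f b u where *: "planelike X A \<Gamma> E S B f" "b \<in> B" "u \<in> loc_dom b c f"
    "loc_map b c f u = x" "range (Dif (loc_map b c f) u) = ?L"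
    using con[unfolded conelike_def, rule_format, OF c x, of ?L] by blast
  have "?L = {p *\<^sub>R E c x + q *\<^sub>R v | p q. True}"
  proof (intro subset_antisym subsetI)
    fix y assume "y \<in> ?L"
    then obtain k where "y - k *\<^sub>R v \<in> span {E c x}" by (auto simp: span_breakdown_eq)
    then obtain p where "y - k *\<^sub>R v = p *\<^sub>R E c x" by (auto simp: span_singleton)
    then have "y = p *\<^sub>R E c x + k *\<^sub>R v" by (simp add: diff_eq_eq)
    then show "y \<in> {p *\<^sub>R E c x + q *\<^sub>R v | p q. True}" by blast
  next
    fix y assume "y \<in> {p *\<^sub>R E c x + q *\<^sub>R v | p q. True}"
    then obtain p q where "y = p *\<^sub>R E c x + q *\<^sub>R v" by blast
    moreover have "E c x \<in> ?L" "v \<in> ?L" by (auto intro: span_base)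
    ultimately show "y \<in> ?L" by (simp add: span_add span_scale)
  qed
  with *(5) have "range (Dif (loc_map b c f) u) = {p *\<^sub>R E c x + q *\<^sub>R v | p q. True}"
    by (rule trans)
  with *(1-4) show ?thesis by (rule that)
qed

section \<open>The modified connection on the manifold\<close>

locale conelike_manifold =
  fixes X :: "'a topology" and A :: "('a, real^'n::finite) chart set"
    and \<Gamma> :: "('a, 'n) connection" and E :: "('a, 'n) vfield"
  assumes manifold: "smooth_manifold X A" and dimension: "CARD('n) > 2"
    and conelike_radiant: "conelike_nonsingular_radiant X A \<Gamma> E"
    and ricci_E: "\<And>c x w. c \<in> A \<Longrightarrow> x \<in> chart_img c \<Longrightarrow> ricci (\<Gamma> c) x (E c x) w = 0"
begin

lemma X: "smooth_structure X A"
  using manifold by (simp add: smooth_manifold_def)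

lemmas charts = structure_chart[OF X]

lemma conelike_structure: "radiant_structure A \<Gamma> E" "nonsingular A E" "conelike X A \<Gamma> E"
  using conelike_radiant by (simp_all add: conelike_nonsingular_radiant_def)

lemma E_nonzero: "c \<in> A \<Longrightarrow> x \<in> chart_img c \<Longrightarrow> E c x \<noteq> 0"
  using conelike_structure(2) by (simp add: nonsingular_def)

lemma conelike_chart:
  assumes c: "c \<in> A"
  shows "conelike_chart (chart_img c) (\<Gamma> c) (E c)"
proof -
  interpret R: radiant_chart "chart_img c" "\<Gamma> c" "E c"
    by (rule radiant_chart_of_structure[OF conelike_structure(1) c charts[OF c]])
  show ?thesis
  proof
    fix x assume x: "x \<in> chart_img c"
    show E: "E c x \<noteq> 0" by (rule E_nonzero[OF c x])
    let ?D = "curvature (\<Gamma> c) x (E c x)"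
    have D: "bilinear ?D"
      unfolding bilinear_def using curvature_linear(2,3)[OF R.G x] by blast
    \<comment> \<open>By symmetry of \<open>?D\<close> and skewness of the curvature this trace is
      minus the Ricci tensor evaluated on \<open>E\<close> and \<open>v\<close>, so the assumption
      on the one-form applies.\<close>
    have tr: "trace (matrix (?D v)) = 0" for v
    proof -
      have "?D v = (\<lambda>u. - curvature (\<Gamma> c) x u (E c x) v)"
      proof
        show "?D v u = - curvature (\<Gamma> c) x u (E c x) v" for u
          using R.curvature_E_commute[OF x, of v u] curvature_skew[of "\<Gamma> c" x "E c x" u v] by simp
      qed
      then have "trace (matrix (?D v)) = - ricci (\<Gamma> c) x (E c x) v"
        by (simp add: trace_matrix_minus ricci_def)
      then show ?thesis by (simp add: ricci_E[OF c x])
    qed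
    \<comment> \<open>A planelike surface tangent to the plane of \<open>E\<close> and
      \<open>v\<close> contains the value in its tangent plane by \<open>curvature_tangent\<close>.
      There is no such plane if \<open>v\<close> is a multiple of \<open>E\<close>, but then the
      value is zero.\<close>
    have planar: "\<exists>p q. ?D v v = p *\<^sub>R E c x + q *\<^sub>R v" for v
    proof (cases "\<exists>k. v = k *\<^sub>R E c x")
      case True
      then obtain k where "v = k *\<^sub>R E c x" by blast
      then have "?D v v = 0 *\<^sub>R E c x + 0 *\<^sub>R v"
        by (simp add: bilinear_lmul[OF D] curvature_same)
      then show ?thesis by blast
    next
      case False
      then have v: "v \<noteq> k *\<^sub>R E c x" for k by blast
      obtain S B f b u where f: "planelike X A \<Gamma> E S B f" and b: "b \<in> B" and u: "u \<in> loc_dom b c f"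
        and hu: "loc_map b c f u = x"
        and ran: "range (Dif (loc_map b c f) u) = {p *\<^sub>R E c x + q *\<^sub>R v | p q. True}"
        by (rule conelike_surface[OF conelike_structure(3) c x E v])
      note surf = planelike_surface[OF f X b c]
      have "E c x = 1 *\<^sub>R E c x + 0 *\<^sub>R v" "v = 0 *\<^sub>R E c x + 1 *\<^sub>R v" by simp_all
      then have "E c x \<in> range (Dif (loc_map b c f) u)" "v \<in> range (Dif (loc_map b c f) u)"
        unfolding ran by blast+
      then obtain e' v' where e': "E c x = Dif (loc_map b c f) u e'" and v': "v = Dif (loc_map b c f) u v'"
        by blast
      have "?D v v \<in> range (Dif (loc_map b c f) u)"
        using curvature_tangent[OF R.G surf(1) u surf(3,2,4,5), of e' v' v']
        unfolding e'[symmetric] v'[symmetric] hu .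
      then show ?thesis unfolding ran by blast
    qed
    show "\<exists>r. ?D v w = r *\<^sub>R E c x" for v w
      by (rule planar_imp_vertical[OF D R.curvature_E_commute[OF x] curvature_same E planar tr])
  qed
qed

text \<open>The zero default is the normalization in the last clause of
  \<open>affine_connection\<close>, which makes uniqueness an equality of functions.\<close>

definition modified :: "('a, 'n) connection" where
  "modified c x = (if c \<in> A \<and> x \<in> chart_img c
     then radiant_chart.modify (\<Gamma> c) (E c) (conelike_chart.correction (\<Gamma> c) (E c)) x else (\<lambda>v w. 0))"

text \<open>For \<open>g = id\<close> this is the transformation law that turns the chartwise
  construction into a connection; for other \<open>g\<close> it yields the statement on group
  actions.\<close>

lemma affine_at_modified:
  assumes g: "automorphism X A \<Gamma> E g" and c: "c \<in> A" and d: "d \<in> A" and x: "x \<in> loc_dom c d g"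
  shows "affine_at (modified c) (modified d) (loc_map c d g) x"
proof -
  have g': "diffeomorphism X A g" and sm: "smooth_map X A X A g" and cont: "continuous_map X X g"
    using g unfolding automorphism_def diffeomorphism_def smooth_map_def by blast+
  interpret C: conelike_chart "chart_img c" "\<Gamma> c" "E c" by (rule conelike_chart[OF c])
  interpret D: conelike_chart "chart_img d" "\<Gamma> d" "E d" by (rule conelike_chart[OF d])
  interpret M: conelike_chart_map "chart_img c" "\<Gamma> c" "E c" "chart_img d" "\<Gamma> d" "E d"
    "loc_dom c d g" "loc_map c d g"
  proof
    show "open (loc_dom c d g)" by (rule open_loc_dom[OF charts[OF c] charts[OF d] cont])
    show "loc_dom c d g \<subseteq> chart_img c" by (rule loc_dom_subset[OF charts[OF c]])
    show "smooth_on (loc_dom c d g) (loc_map c d g)" by (rule loc_map_smooth[OF sm c d])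
    fix y assume y: "y \<in> loc_dom c d g"
    show "loc_map c d g y \<in> chart_img d" by (rule loc_map_in[OF charts[OF c] y])
    show "affine_at (\<Gamma> c) (\<Gamma> d) (loc_map c d g) y" "E d (loc_map c d g y) = Dif (loc_map c d g) y (E c y)"
      using g c d y unfolding automorphism_def by blast+
    show "\<exists>k. linear k \<and> (\<forall>v. k (Dif (loc_map c d g) y v) = v) \<and> (\<forall>v. Dif (loc_map c d g) y (k v) = v)"
      by (rule diffeomorphism_Dif_invertible[OF X g' c d y])
  qed
  have "x \<in> chart_img c" "loc_map c d g x \<in> chart_img d"
    using M.U x M.h_in by blast+
  then show ?thesis
    using M.affine_at_modify_correction[OF x] c d unfolding affine_at_def modified_def by simp
qed

lemma automorphism_id: "automorphism X A \<Gamma> E id"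
proof -
  have "smooth_map X A X A id"
    using X by (auto simp: smooth_map_def smooth_structure_def)
  then have "diffeomorphism X A id"
    unfolding diffeomorphism_def by auto
  then show ?thesis
    using conelike_structure(1)
    unfolding automorphism_def radiant_structure_def affine_connection_def smooth_vector_field_def by blast
qed

lemma modified_vertical:
  assumes c: "c \<in> A" and x: "x \<in> chart_img c"
  shows "modified c x v w = \<Gamma> c x v w + conelike_chart.correction (\<Gamma> c) (E c) x v w *\<^sub>R E c x"
proof -
  interpret C: conelike_chart "chart_img c" "\<Gamma> c" "E c" by (rule conelike_chart[OF c])
  show ?thesis using c x by (simp add: modified_def C.modify_def)
qed

lemma modified_chart:
  assumes c: "c \<in> A"
  shows "radiant_chart (chart_img c) (modified c) (E c)"
    and "x \<in> chart_img c \<Longrightarrow> lie_derivative_conn (modified c) (E c) x v w = 0"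
    and "x \<in> chart_img c \<Longrightarrow> ricci (modified c) x v w = (ricci (\<Gamma> c) x v w - ricci (\<Gamma> c) x w v) / 2"
    and "x \<in> chart_img c \<Longrightarrow> trace (matrix (modified c x v)) = trace (matrix (\<Gamma> c x v))"
proof -
  interpret C: conelike_chart "chart_img c" "\<Gamma> c" "E c" by (rule conelike_chart[OF c])
  interpret M: radiant_chart "chart_img c" "C.modify C.correction" "E c"
    by (rule C.radiant_chart_modify[OF C.horizontal_correction])
  have eq: "C.modify C.correction y = modified c y" if "y \<in> chart_img c" for y
    using that c by (simp add: modified_def)
  show R: "radiant_chart (chart_img c) (modified c) (E c)"
  proof
    have "smooth_on (chart_img c) (\<lambda>x. modified c x v w)" for v w
      by (rule smooth_on_cong[OF C.S_open _ christoffel_smooth[OF M.G]]) (simp add: eq)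
    then show "christoffel_on (chart_img c) (modified c)"
      using M.G unfolding christoffel_on_def by (simp add: eq[symmetric])
    show "covd (modified c) v (E c) x = v" if "x \<in> chart_img c" for x v
      using M.radiant[OF that, of v] by (simp add: covd_def eq[OF that])
  qed (rule C.E_smooth)
  assume x: "x \<in> chart_img c"
  show "lie_derivative_conn (modified c) (E c) x v w = 0"
  proof -
    have "curvature (C.modify C.correction) x (E c x) v w = curvature (modified c) x (E c x) v w"
      by (rule curvature_cong[OF C.S_open x eq])
    then show ?thesis
      using C.lie_derivative_conn_correction[OF x dimension, of v w]
      unfolding radiant_chart.lie_derivative_conn_eq_curvature[OF R x] M.lie_derivative_conn_eq_curvature[OF x]
      by simp
  qed
  show "ricci (modified c) x v w = (ricci (\<Gamma> c) x v w - ricci (\<Gamma> c) x w v) / 2"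
  proof -
    have "ricci (C.modify C.correction) x v w = ricci (modified c) x v w"
      by (rule ricci_cong[OF C.S_open x eq])
    then show ?thesis
      using C.ricci_correction[OF x dimension, of v w] by simp
  qed
  \<comment> \<open>The added endomorphism has rank at most one and trace
    \<open>C.correction x v (E c x)\<close>, which is zero; so the connection on densities is
    unchanged.\<close>
  have "modified c x v = (\<lambda>w. \<Gamma> c x v w + C.correction x v w *\<^sub>R E c x)"
    by (rule ext) (rule modified_vertical[OF c x])
  then have "trace (matrix (modified c x v)) = trace (matrix (\<Gamma> c x v)) + C.correction x v (E c x)"
    by (simp add: trace_matrix_add trace_matrix_rank_one[OF C.horizontal_linear[OF C.horizontal_correction x]])
  then show "trace (matrix (modified c x v)) = trace (matrix (\<Gamma> c x v))"
    by (simp add: C.horizontal_E_right[OF C.horizontal_correction x])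
qed

lemma planelike_modified: "planelike X A modified E S B f \<longleftrightarrow> planelike X A \<Gamma> E S B f"
proof
  assume "planelike X A \<Gamma> E S B f"
  then show "planelike X A modified E S B f"
    by (rule planelike_transfer[OF _ X]) (use modified_vertical in blast)
next
  assume f: "planelike X A modified E S B f"
  have "\<exists>r. \<Gamma> c x v w = modified c x v w + r *\<^sub>R E c x" if "c \<in> A" "x \<in> chart_img c" for c x v w
    by (rule exI[of _ "- conelike_chart.correction (\<Gamma> c) (E c) x v w"]) (simp add: modified_vertical[OF that])
  then show "planelike X A \<Gamma> E S B f"
    by (rule planelike_transfer[OF f X])
qed

lemma antisymmetric_modification_modified: "antisymmetric_modification X A \<Gamma> E modified"
proof -
  note M = modified_chart
  have aff: "affine_connection A modified"
    unfolding affine_connection_def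
  proof (intro conjI ballI allI impI)
    show "bilinear (modified c x)" if "c \<in> A" "x \<in> chart_img c" for c x
      by (rule christoffel_bilinear[OF radiant_chart.G[OF M(1)[OF that(1)]] that(2)])
    show "smooth_on (chart_img c) (\<lambda>x. modified c x v w)" if "c \<in> A" for c v w
      by (rule christoffel_smooth[OF radiant_chart.G[OF M(1)[OF that]]])
    show "affine_at (modified c) (modified d) (loc_map c d id) x"
      if "c \<in> A" "d \<in> A" "x \<in> loc_dom c d id" for c d x
      by (rule affine_at_modified[OF automorphism_id that])
    show "modified c x = (\<lambda>v w. 0)" if "c \<notin> A \<or> x \<notin> chart_img c" for c x
      using that by (auto simp: modified_def)
  qed
  have "torsion_free A modified"
    unfolding torsion_free_def
    using christoffel_commute[OF radiant_chart.G[OF M(1)]] by blast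
  moreover have "covd (modified c) v (E c) x = v" if "c \<in> A" "x \<in> chart_img c" for c x v
    by (rule radiant_chart.radiant[OF M(1)[OF that(1)] that(2)])
  ultimately have rad: "radiant_structure A modified E"
    using aff conelike_structure(1) unfolding radiant_structure_def by blast
  \<comment> \<open>No surface has to be constructed: those of the original structure are planelike
    for \<open>modified\<close>.\<close>
  have con: "conelike X A modified E"
    using conelike_structure(3) unfolding conelike_def planelike_modified .
  have dens: "same_density_connection A \<Gamma> modified"
    unfolding same_density_connection_def density_covd_def using M(4) by simp
  have ric: "ricci_antisymmetric A modified"
    unfolding ricci_antisymmetric_def
  proof (intro ballI allI)
    show "ricci (modified c) x y z = - ricci (modified c) x z y" if "c \<in> A" "x \<in> chart_img c" for c x y z
      using M(3)[OF that, of y z] M(3)[OF that, of z y] by simp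
  qed
  have inv: "E_invariant A modified E"
    unfolding E_invariant_def using M(2) by blast
  show ?thesis
    unfolding antisymmetric_modification_def conelike_nonsingular_radiant_def same_planelike_surfaces_def
      planelike_modified
    using rad con dens ric inv conelike_structure(2) by blast
qed

lemma modification_unique:
  assumes 1: "antisymmetric_modification X A \<Gamma> E \<Gamma>1" and 2: "antisymmetric_modification X A \<Gamma> E \<Gamma>2"
  shows "\<Gamma>2 = \<Gamma>1"
proof (intro ext)
  fix c x v w
  have "\<Gamma>2 c x = \<Gamma>1 c x"
  proof (cases "c \<in> A \<and> x \<in> chart_img c")
    case False
    then have "\<Gamma>' c x = (\<lambda>v w. 0)" if "antisymmetric_modification X A \<Gamma> E \<Gamma>'" for \<Gamma>'
      using that unfolding antisymmetric_modification_def conelike_nonsingular_radiant_def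
        radiant_structure_def affine_connection_def by blast
    from this[OF 1] this[OF 2] show ?thesis by simp
  next
    case True
    then have c: "c \<in> A" and x: "x \<in> chart_img c" by simp_all
    have R: "radiant_chart (chart_img c) (\<Gamma>' c) (E c)" if "antisymmetric_modification X A \<Gamma> E \<Gamma>'" for \<Gamma>'
      using that radiant_chart_of_structure[OF _ c charts[OF c]]
      unfolding antisymmetric_modification_def conelike_nonsingular_radiant_def by blast
    interpret R1: radiant_chart "chart_img c" "\<Gamma>1 c" "E c" by (rule R[OF 1])
    interpret R2: radiant_chart "chart_img c" "\<Gamma>2 c" "E c" by (rule R[OF 2])
    have tr: "trace (matrix (\<Gamma>' c x v)) = trace (matrix (\<Gamma> c x v))"
      if "antisymmetric_modification X A \<Gamma> E \<Gamma>'" "x \<in> chart_img c" for \<Gamma>' x v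
    proof -
      \<comment> \<open>On the density with constant coefficient 1 the covariant derivative is just
        minus the trace.\<close>
      have "density_covd (\<Gamma> c) v (\<lambda>_. 1) x = density_covd (\<Gamma>' c) v (\<lambda>_. 1) x"
        using that c smooth_on_const[of "chart_img c" "1::real"]
        unfolding antisymmetric_modification_def same_density_connection_def by blast
      then show ?thesis by (simp add: density_covd_def)
    qed
    have lie: "lie_derivative_conn (\<Gamma>' c) (E c) x v w = 0"
      and ric: "ricci (\<Gamma>' c) x v w = - ricci (\<Gamma>' c) x w v"
      if "antisymmetric_modification X A \<Gamma> E \<Gamma>'" "x \<in> chart_img c" for \<Gamma>' x v w
      using that c unfolding antisymmetric_modification_def E_invariant_def ricci_antisymmetric_def by blast+
    have planar: "\<exists>p q. \<Gamma>2 c x v v - \<Gamma>1 c x v v = p *\<^sub>R E c x + q *\<^sub>R v" if x: "x \<in> chart_img c" for x v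
    proof (cases "\<exists>k. v = k *\<^sub>R E c x")
      case True
      then obtain k where v: "v = k *\<^sub>R E c x" by blast
      have "\<Gamma>2 c x v (E c x) = \<Gamma>1 c x v (E c x)"
        using R1.Dif_E[OF x, of v] R2.Dif_E[OF x, of v] by simp
      then have "k *\<^sub>R \<Gamma>2 c x v (E c x) = k *\<^sub>R \<Gamma>1 c x v (E c x)" by simp
      then have "\<Gamma>2 c x v v = \<Gamma>1 c x v v"
        using linear_scale[OF christoffel_linear[OF R1.G x], of v k "E c x"]
          linear_scale[OF christoffel_linear[OF R2.G x], of v k "E c x"] by (simp add: v)
      then have "\<Gamma>2 c x v v - \<Gamma>1 c x v v = 0 *\<^sub>R E c x + 0 *\<^sub>R v" by simp
      then show ?thesis by blast
    next
      case False
      then have v: "v \<noteq> k *\<^sub>R E c x" for k by blast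
      obtain S B f b u where f: "planelike X A \<Gamma> E S B f" and b: "b \<in> B" and u: "u \<in> loc_dom b c f"
        and hu: "loc_map b c f u = x"
        and ran: "range (Dif (loc_map b c f) u) = {p *\<^sub>R E c x + q *\<^sub>R v | p q. True}"
        by (rule conelike_surface[OF conelike_structure(3) c x E_nonzero[OF c x] v])
      have f1: "planelike X A \<Gamma>1 E S B f" and f2: "planelike X A \<Gamma>2 E S B f"
        using f 1 2 unfolding antisymmetric_modification_def same_planelike_surfaces_def by blast+
      have "v = 0 *\<^sub>R E c x + 1 *\<^sub>R v" by simp
      then have "v \<in> range (Dif (loc_map b c f) u)"
        unfolding ran by blast
      then obtain v' where v': "v = Dif (loc_map b c f) u v'"
        by blast
      \<comment> \<open>The surface is planelike for both connections. In the difference its second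
        derivatives cancel, leaving the difference of the Christoffel symbols at
        \<open>v\<close>.\<close>
      have "covd_along (\<Gamma>2 c) (loc_map b c f) v' (\<lambda>t. Dif (loc_map b c f) t v') u
        - covd_along (\<Gamma>1 c) (loc_map b c f) v' (\<lambda>t. Dif (loc_map b c f) t v') u
        \<in> range (Dif (loc_map b c f) u)"
        by (rule subspace_diff[OF planelike_surface(7)[OF f X b c u]
              planelike_surface(5)[OF f2 X b c u] planelike_surface(5)[OF f1 X b c u]])
      then have "\<Gamma>2 c x v v - \<Gamma>1 c x v v \<in> range (Dif (loc_map b c f) u)"
        unfolding covd_along_def v'[symmetric] hu by simp
      then show ?thesis unfolding ran by blast
    qed
    show ?thesis
      by (rule R1.modification_unique[OF R2.radiant_chart_axioms E_nonzero[OF c] dimension planar _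
            lie[OF 1] lie[OF 2] ric[OF 1] ric[OF 2] x]) (simp_all add: tr[OF 1] tr[OF 2])
  qed
  then show "\<Gamma>2 c x v w = \<Gamma>1 c x v w" by simp
qed

text \<open>Reduces uniqueness in the Ricci-flat case to uniqueness in the antisymmetric
  one.\<close>

lemma flat_imp_antisymmetric: "flat_modification X A \<Gamma> E \<Gamma>' \<Longrightarrow> antisymmetric_modification X A \<Gamma> E \<Gamma>'"
  by (simp add: flat_modification_def antisymmetric_modification_def ricci_flat_def ricci_antisymmetric_def)

lemma flat_modification_modified:
  assumes "ricci_symmetric A \<Gamma>"
  shows "flat_modification X A \<Gamma> E modified"
proof -
  have "ricci_flat A modified"
    using assms modified_chart(3) unfolding ricci_flat_def ricci_symmetric_def by simp
  then show ?thesis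
    using antisymmetric_modification_modified
    unfolding flat_modification_def antisymmetric_modification_def by blast
qed

lemma automorphism_modified: "automorphism X A \<Gamma> E g \<Longrightarrow> automorphism X A modified E g"
  using affine_at_modified unfolding automorphism_def by blast

end

theorem theorem5p7:
  fixes X :: "'a topology" and A :: "('a, real^'n::finite) chart set"
    and \<Gamma> :: "('a, 'n) connection" and E :: "('a, 'n) vfield"
    and G :: "('g, 'm) monoid_scheme" and T :: "'g topology"
    and B :: "('g, 'v::real_normed_vector) chart set" and \<phi> :: "'g \<Rightarrow> 'a \<Rightarrow> 'a"
  assumes "smooth_manifold X A" and "CARD('n) > 2"
    and "conelike_nonsingular_radiant X A \<Gamma> E"
    and "\<forall>c\<in>A. \<forall>x\<in>chart_img c. \<forall>w. ricci (\<Gamma> c) x (E c x) w = 0"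
  shows "(\<exists>!\<Gamma>'. antisymmetric_modification X A \<Gamma> E \<Gamma>') \<and>
    (\<forall>\<Gamma>'. antisymmetric_modification X A \<Gamma> E \<Gamma>' \<longrightarrow>
       lie_group G T B \<and> acts_by_automorphisms G T B X A \<phi> \<Gamma> E \<longrightarrow>
       acts_by_automorphisms G T B X A \<phi> \<Gamma>' E) \<and>
    (ricci_symmetric A \<Gamma> \<longrightarrow> (\<exists>!\<Gamma>'. flat_modification X A \<Gamma> E \<Gamma>'))"
proof -
  interpret conelike_manifold X A \<Gamma> E
    using assms by unfold_locales auto
  \<comment> \<open>Uniqueness transfers what is known of \<open>modified\<close>, in particular its
    naturality, to any connection with the required properties.\<close>
  have uniq: "\<Gamma>' = modified" if "antisymmetric_modification X A \<Gamma> E \<Gamma>'" for \<Gamma>'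
    by (rule modification_unique[OF antisymmetric_modification_modified that])
  show ?thesis
  proof (intro conjI allI impI)
    show "\<exists>!\<Gamma>'. antisymmetric_modification X A \<Gamma> E \<Gamma>'"
      using antisymmetric_modification_modified uniq by blast
    show "acts_by_automorphisms G T B X A \<phi> \<Gamma>' E"
      if "antisymmetric_modification X A \<Gamma> E \<Gamma>'"
        and "lie_group G T B \<and> acts_by_automorphisms G T B X A \<phi> \<Gamma> E" for \<Gamma>'
      using that(2) automorphism_modified unfolding uniq[OF that(1)] acts_by_automorphisms_def by blast
    show "\<exists>!\<Gamma>'. flat_modification X A \<Gamma> E \<Gamma>'" if "ricci_symmetric A \<Gamma>"
      using flat_modification_modified[OF that] uniq flat_imp_antisymmetric by blast
  qed
qed

end
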